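(* Let $k^*$ be the maximal type of $f$, i.e. the largest type among the (finitely many) global maximum points of $f$, and let $\mu_1,\dots,\mu_P$ be the global maximum points of $f$ whose type equals $k^*$, with strengths $\lambda_1,\dots,\lambda_P$. Then, as $N\to\infty$, the law of $m_N(\sigma)$ under $P_N$ converges weakly to the probability measure $$\frac{\sum_{p=1}^P b_p\,\delta_{\mu_p}}{\sum_{p=1}^P b_p},\qquad b_p=(-\lambda_p)^{-1/(2k^* )},$$ where $\delta_{\mu_p}$ is the unit point mass at $\mu_p$.
   Context: Let $\rho$ be a non-degenerate Borel probability measure on $\mathbb{R}$ such that $\int_{\mathbb{R}}\exp\big(\tfrac{a x^2}{2}+bx\big)\,d\rho(x)<\infty$ for all $a>0$, $b\in\mathbb{R}$. Fix $J>0$ and $h\in\mathbb{R}$. For $N\ge1$ and $\sigma=(\sigma_1,\dots,\sigma_N)\in\mathbb{R}^N$ let $H_N(\sigma)=-\frac{J}{2N}\sum_{i,j=1}^N\sigma_i\sigma_j-h\sum_{i=1}^N\sigma_i$, and let $P_N$ be the probability measure on $\mathbb{R}^N$ given by $dP_N(\sigma)=Z_N^{-1}\exp(-H_N(\sigma))\prod_{i=1}^N d\rho(\sigma_i)$, where $Z_N$ is the normalizing constant. Let $S_N(\sigma)=\sum_{i=1}^N\sigma_i$ and $m_N(\sigma)=S_N(\sigma)/N$. Define $f(x)=-\frac{J}{2}x^2+\ln\int_{\mathbb{R}}\exp\big(s(Jx+h)\big)\,d\rho(s)$; $f$ is real analytic, tends to $-\infty$ at $\pm\infty$ and has finitely many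 global maximum points. For a global maximum point $\mu$ of $f$, its type is the positive integer $k$ and its strength is the negative real $\lambda$ such that $f^{(j)}(\mu)=0$ for $1\le j\le 2k-1$ and $f^{(2k)}(\mu)=\lambda<0$, i.e. $f(x)=f(\mu)+\lambda\frac{(x-\mu)^{2k}}{(2k)!}+o((x-\mu)^{2k})$ as $x\to\mu$. *)

theory Defs
  imports "HOL-Probability.Probability"
begin

definition weak_conv_to :: "(nat \<Rightarrow> real measure) \<Rightarrow> real measure \<Rightarrow> bool" where
  "weak_conv_to Ms M \<longleftrightarrow>
     (\<forall>g :: real \<Rightarrow> real. continuous_on UNIV g \<and> bounded (range g) \<longrightarrow>
        (\<lambda>n. integral\<^sup>L (Ms n) g) \<longlonglongrightarrow> integral\<^sup>L M g)"

definition hamil :: "real \<Rightarrow> real \<Rightarrow> nat \<Rightarrow> (nat \<Rightarrow> real) \<Rightarrow> real" where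
  "hamil J h N \<sigma> = - J / (2 * real N) * (\<Sum>i<N. \<Sum>j<N. \<sigma> i * \<sigma> j) - h * (\<Sum>i<N. \<sigma> i)"

definition partfun :: "real measure \<Rightarrow> real \<Rightarrow> real \<Rightarrow> nat \<Rightarrow> real" where
  "partfun \<rho> J h N = (\<integral>\<sigma>. exp (- hamil J h N \<sigma>) \<partial>(PiM {..<N} (\<lambda>_. \<rho>)))"

definition gibbs :: "real measure \<Rightarrow> real \<Rightarrow> real \<Rightarrow> nat \<Rightarrow> (nat \<Rightarrow> real) measure" where
  "gibbs \<rho> J h N = density (PiM {..<N} (\<lambda>_. \<rho>))
      (\<lambda>\<sigma>. ennreal (exp (- hamil J h N \<sigma>) / partfun \<rho> J h N))"

definition magn :: "nat \<Rightarrow> (nat \<Rightarrow> real) \<Rightarrow> real" where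
  "magn N \<sigma> = (\<Sum>i<N. \<sigma> i) / real N"

definition magn_law :: "real measure \<Rightarrow> real \<Rightarrow> real \<Rightarrow> nat \<Rightarrow> real measure" where
  "magn_law \<rho> J h N = distr (gibbs \<rho> J h N) borel (magn N)"

definition fCW :: "real measure \<Rightarrow> real \<Rightarrow> real \<Rightarrow> real \<Rightarrow> real" where
  "fCW \<rho> J h x = - J / 2 * x\<^sup>2 + ln (\<integral>s. exp (s * (J * x + h)) \<partial>\<rho>)"

definition global_max_points :: "(real \<Rightarrow> real) \<Rightarrow> real set" where
  "global_max_points g = {\<mu>. \<forall>x. g x \<le> g \<mu>}"

definition has_type :: "(real \<Rightarrow> real) \<Rightarrow> real \<Rightarrow> nat \<Rightarrow> bool" where
  "has_type g \<mu> k \<longleftrightarrow> k \<ge> 1 \<and> (\<forall>j\<in>{1..2*k-1}. (deriv ^^ j) g \<mu> = 0) \<and> (deriv ^^ (2*k)) g \<mu> < 0"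

definition point_type :: "(real \<Rightarrow> real) \<Rightarrow> real \<Rightarrow> nat" where
  "point_type g \<mu> = (THE k. has_type g \<mu> k)"

definition point_strength :: "(real \<Rightarrow> real) \<Rightarrow> real \<Rightarrow> real" where
  "point_strength g \<mu> = (deriv ^^ (2 * point_type g \<mu>)) g \<mu>"

definition max_type :: "(real \<Rightarrow> real) \<Rightarrow> nat" where
  "max_type g = Max (point_type g ` global_max_points g)"

definition max_type_points :: "(real \<Rightarrow> real) \<Rightarrow> real set" where
  "max_type_points g = {\<mu> \<in> global_max_points g. point_type g \<mu> = max_type g}"

definition cw_weight :: "(real \<Rightarrow> real) \<Rightarrow> real \<Rightarrow> real" where
  "cw_weight g \<mu> = (- point_strength g \<mu>) powr (- 1 / (2 * real (max_type g)))"

definition cw_limit :: "(real \<Rightarrow> real) \<Rightarrow> real measure" where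
  "cw_limit g = measure_pmf (embed_pmf (\<lambda>x. if x \<in> max_type_points g
       then cw_weight g x / (\<Sum>p\<in>max_type_points g. cw_weight g p) else 0))"

end

theory Submission
  imports Defs "HOL-Complex_Analysis.Complex_Analysis" "HOL-Real_Asymp.Real_Asymp"
begin

text \<open>Adding to the magnetization an independent centred Gaussian of variance \<open>1 / (N J)\<close> gives a
  variable whose density is proportional to \<open>exp (N f)\<close> (Hubbard--Stratonovich).  By Laplace's method
  a global maximum point of type \<open>k\<close> and strength \<open>\<lambda>\<close> contributes mass of order
  \<open>N powr (- 1 / (2 * k))\<close>, with a constant proportional to \<open>(- \<lambda>) powr (- 1 / (2 * k))\<close>, so only the points of maximal
  type survive.  On the level of characteristic functions the Gaussian is the factor
  \<open>exp (- t\<^sup>2 / (2 N J))\<close>, which tends to 1, and Levy's continuity theorem gives weak convergence.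
  Types exist because \<open>exp f\<close> extends to an entire function.\<close>

subsection \<open>Types of maximum points\<close>

text \<open>It is \<open>exp f\<close> rather than \<open>f\<close> that continues to the plane: the
  moment generating function may vanish off the real axis, so a holomorphic logarithm is only
  available near real points. That local logarithm gives \<open>f\<close> real derivatives of all
  orders, so that iterated \<open>deriv\<close> has its intended meaning; the identity theorem is
  then applied to the entire function.

  The variance \<open>1 / (N J)\<close> is forced: its quadratic term cancels the interaction and
  leaves a power of a one-spin integral. Working with transforms avoids deconvolution, because the
  Gaussian factor never vanishes and can be divided out exactly at every finite \<open>N\<close>.
  The partition function, the power of \<open>N\<close> and the exponential of \<open>N\<close>
  times the maximum of \<open>f\<close> enter the transform at \<open>t\<close> and at
  \<open>0\<close> alike, so only a ratio of two Laplace asymptotics is needed.\<close>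

lemma real_higher_deriv_of_holomorphic:
  fixes f :: "real \<Rightarrow> real" and g :: "complex \<Rightarrow> complex"
  assumes g: "g holomorphic_on ball (of_real \<mu>) r"
    and fg: "\<And>x. \<bar>x - \<mu>\<bar> < r \<Longrightarrow> g (of_real x) = of_real (f x)"
    and x: "\<bar>x - \<mu>\<bar> < r"
  shows "(deriv ^^ n) g (of_real x) = of_real ((deriv ^^ n) f x)"
    and "((deriv ^^ n) f has_real_derivative (deriv ^^ Suc n) f x) (at x)"
proof -
  \<comment> \<open>The real part of the complex derivative differentiates
    \<open>(deriv ^^ n) f\<close>. The imaginary part differentiates a function that is zero near
    \<open>x\<close>, so it vanishes and the complex derivative is real.\<close>
  have step: "((deriv ^^ n) f has_real_derivative (deriv ^^ Suc n) f x) (at x) \<and>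
      (deriv ^^ Suc n) g (of_real x) = of_real ((deriv ^^ Suc n) f x)"
    if IH: "\<And>x. \<bar>x - \<mu>\<bar> < r \<Longrightarrow> (deriv ^^ n) g (of_real x) = of_real ((deriv ^^ n) f x)"
      and x: "\<bar>x - \<mu>\<bar> < r" for n x
  proof -
    define D where "D = (deriv ^^ Suc n) g (of_real x)"
    have in_ball: "complex_of_real y \<in> ball (of_real \<mu>) r \<longleftrightarrow> \<bar>y - \<mu>\<bar> < r" for y
      by (simp add: dist_norm abs_minus_commute flip: of_real_diff)
    have "(deriv ^^ n) g holomorphic_on ball (of_real \<mu>) r"
      by (intro holomorphic_higher_deriv g) simp
    then have "((deriv ^^ n) g has_field_derivative D) (at (of_real x))"
      using x in_ball unfolding D_def by (auto intro!: holomorphic_derivI)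
    then have vd: "((\<lambda>y. (deriv ^^ n) g (of_real y)) has_vector_derivative D) (at x)"
      by (rule has_vector_derivative_real_field)
    have near: "\<forall>\<^sub>F y in nhds x. \<bar>y - \<mu>\<bar> < r"
      by (rule eventually_nhds_in_open[of "{y. \<bar>y - \<mu>\<bar> < r}", simplified])
        (use x in \<open>auto intro!: open_Collect_less continuous_intros\<close>)
    have "((\<lambda>y. Re ((deriv ^^ n) g (of_real y))) has_vector_derivative Re D) (at x)"
      by (rule bounded_linear.has_vector_derivative[OF bounded_linear_Re vd])
    then have re: "((deriv ^^ n) f has_real_derivative Re D) (at x)"
      unfolding has_real_derivative_iff_has_vector_derivative[symmetric]
      by (rule DERIV_cong_ev[THEN iffD1, rotated -1]) (use near in \<open>auto elim!: eventually_mono simp: IH\<close>)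
    have "((\<lambda>y. Im ((deriv ^^ n) g (of_real y))) has_vector_derivative Im D) (at x)"
      by (rule bounded_linear.has_vector_derivative[OF bounded_linear_Im vd])
    then have "((\<lambda>y. 0) has_real_derivative Im D) (at x)"
      unfolding has_real_derivative_iff_has_vector_derivative[symmetric]
      by (rule DERIV_cong_ev[THEN iffD1, rotated -1]) (use near in \<open>auto elim!: eventually_mono simp: IH\<close>)
    then have "Im D = 0"
      by (rule DERIV_unique) simp
    moreover have "(deriv ^^ Suc n) f x = Re D"
      using DERIV_imp_deriv[OF re] by simp
    ultimately show ?thesis
      using re unfolding D_def by (simp add: complex_eq_iff)
  qed
  have eq: "(deriv ^^ n) g (of_real x) = of_real ((deriv ^^ n) f x)" if "\<bar>x - \<mu>\<bar> < r" for n x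
    using that
  proof (induction n arbitrary: x)
    case 0
    then show ?case by (simp add: fg)
  next
    case (Suc n)
    then show ?case using step[of n x] by blast
  qed
  show "(deriv ^^ n) g (of_real x) = of_real ((deriv ^^ n) f x)"
    by (rule eq[OF x])
  show "((deriv ^^ n) f has_real_derivative (deriv ^^ Suc n) f x) (at x)"
    using step[of n x] eq x by blast
qed

text \<open>Lagrange remainder: the terms of order strictly between 0 and \<open>n\<close> vanish,
  and the intermediate point \<open>t\<close> tends to \<open>c\<close>, where the derivative of
  order \<open>n\<close> is continuous. A limit of quotients is the form used both by the sign
  argument and by the Laplace substitution.\<close>

lemma taylor_leading_term:
  fixes f :: "real \<Rightarrow> real"
  assumes r: "0 < r"
    and deriv: "\<And>m x. \<bar>x - c\<bar> < r \<Longrightarrow> ((deriv ^^ m) f has_real_derivative (deriv ^^ Suc m) f x) (at x)"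
    and n: "0 < n" and zero: "\<And>j. 0 < j \<Longrightarrow> j < n \<Longrightarrow> (deriv ^^ j) f c = 0"
  shows "((\<lambda>z. (f (c + z) - f c) / z ^ n) \<longlongrightarrow> (deriv ^^ n) f c / fact n) (at 0)"
proof (rule tendstoI)
  fix e :: real assume e: "0 < e"
  have "isCont ((deriv ^^ n) f) c"
    using deriv[of c n] r by (intro DERIV_isCont) auto
  then have "((\<lambda>x. (deriv ^^ n) f x / fact n) \<longlongrightarrow> (deriv ^^ n) f c / fact n) (at c)"
    unfolding isCont_def by (intro tendsto_intros) auto
  then have "\<forall>\<^sub>F x in at c. dist ((deriv ^^ n) f x / fact n) ((deriv ^^ n) f c / fact n) < e"
    using e by (rule tendstoD)
  then obtain d where d: "0 < d"
      "\<And>t. t \<noteq> c \<Longrightarrow> \<bar>t - c\<bar> < d \<Longrightarrow> dist ((deriv ^^ n) f t / fact n) ((deriv ^^ n) f c / fact n) < e"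
    unfolding eventually_at by (auto simp: dist_real_def)
  have "dist ((f (c + z) - f c) / z ^ n) ((deriv ^^ n) f c / fact n) < e"
    if z: "z \<noteq> 0" "\<bar>z\<bar> < min d r" for z
  proof -
    have "\<exists>t. (if c + z < c then c + z < t \<and> t < c else c < t \<and> t < c + z) \<and>
        f (c + z) = (\<Sum>m<n. (deriv ^^ m) f c / fact m * ((c + z) - c) ^ m)
          + (deriv ^^ n) f t / fact n * ((c + z) - c) ^ n"
      using z deriv n by (intro Taylor[where a = "c - \<bar>z\<bar>" and b = "c + \<bar>z\<bar>"]) auto
    then obtain t where between: "if c + z < c then c + z < t \<and> t < c else c < t \<and> t < c + z"
      and eq: "f (c + z) = (\<Sum>m<n. (deriv ^^ m) f c / fact m * z ^ m) + (deriv ^^ n) f t / fact n * z ^ n"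
      unfolding add_diff_cancel_left' by blast
    from between have t: "\<bar>t - c\<bar> < \<bar>z\<bar>" "t \<noteq> c"
      by (auto split: if_splits)
    have "(\<Sum>m<n. (deriv ^^ m) f c / fact m * z ^ m) = (\<Sum>m\<in>{0}. (deriv ^^ m) f c / fact m * z ^ m)"
      using n zero by (intro sum.mono_neutral_right) auto
    then have "(f (c + z) - f c) / z ^ n = (deriv ^^ n) f t / fact n"
      using eq z by simp
    then show ?thesis
      using d(2)[OF t(2)] t(1) z by simp
  qed
  then show "\<forall>\<^sub>F z in at 0. dist ((f (c + z) - f c) / z ^ n) ((deriv ^^ n) f c / fact n) < e"
    unfolding eventually_at using d(1) r by (intro exI[of _ "min d r"]) (auto simp: dist_real_def)
qed

text \<open>At a maximum the numerator is never positive. The right-hand limit fixes the sign of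
  \<open>L\<close>; for odd \<open>n\<close> the left-hand quotients would be nonnegative, a
  contradiction.\<close>

lemma leading_term_at_maximum:
  fixes f :: "real \<Rightarrow> real"
  assumes lim: "((\<lambda>z. (f (c + z) - f c) / z ^ n) \<longlongrightarrow> L) (at 0)" and L: "L \<noteq> 0"
    and max: "\<And>x. f x \<le> f c"
  shows "even n" "L < 0"
proof -
  have right: "((\<lambda>z. (f (c + z) - f c) / z ^ n) \<longlongrightarrow> L) (at_right 0)"
    and left: "((\<lambda>z. (f (c + z) - f c) / z ^ n) \<longlongrightarrow> L) (at_left 0)"
    using lim by (auto intro: tendsto_within_subset)
  have "\<forall>\<^sub>F z in at_right 0. (f (c + z) - f c) / z ^ n \<le> 0"
    using eventually_at_right_less[of "0::real"] max
    by (auto elim!: eventually_mono simp: divide_le_0_iff)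
  from tendsto_upperbound[OF right this] have "L \<le> 0"
    by simp
  with L show "L < 0" by simp
  show "even n"
  proof (rule ccontr)
    assume "odd n"
    have "\<forall>\<^sub>F z in at_left 0. z < (0::real)"
      by (simp add: eventually_at_filter)
    then have "\<forall>\<^sub>F z in at_left 0. 0 \<le> (f (c + z) - f c) / z ^ n"
      using max \<open>odd n\<close>
      by (auto elim!: eventually_mono simp: zero_le_divide_iff power_le_zero_eq)
    from tendsto_lowerbound[OF left this] show False
      using \<open>L < 0\<close> by simp
  qed
qed

text \<open>With two types \<open>k < l\<close>, the derivative of order \<open>2 * k\<close> would
  be negative by the first and zero by the second; hence the definite description in
  \<open>point_type\<close> denotes.\<close>

lemma point_type_eq:
  assumes "has_type g \<mu> k"
  shows "point_type g \<mu> = k"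
  unfolding point_type_def
proof (rule the_equality)
  show "has_type g \<mu> k" by fact
  have less: "\<not> k < l" if "has_type g \<mu> k" "has_type g \<mu> l" for k l
  proof
    assume "k < l"
    then have "2 * k \<in> {1..2 * l - 1}"
      using that by (auto simp: has_type_def)
    then show False
      using that unfolding has_type_def by fastforce
  qed
  fix l assume "has_type g \<mu> l"
  then show "l = k"
    using less[of k l] less[of l k] assms by simp
qed

text \<open>The least order \<open>n\<close> of a nonvanishing derivative is even and that
  derivative is negative because \<open>c\<close> is a maximum, so \<open>n\<close> is twice the
  type.\<close>

lemma has_type_of_nonvanishing_deriv:
  fixes f :: "real \<Rightarrow> real"
  assumes r: "0 < r"
    and deriv: "\<And>m x. \<bar>x - c\<bar> < r \<Longrightarrow> ((deriv ^^ m) f has_real_derivative (deriv ^^ Suc m) f x) (at x)"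
    and nz: "0 < m" "(deriv ^^ m) f c \<noteq> 0"
    and max: "\<And>x. f x \<le> f c"
  shows "has_type f c (point_type f c)"
    and "((\<lambda>z. (f (c + z) - f c) / z ^ (2 * point_type f c))
      \<longlongrightarrow> point_strength f c / fact (2 * point_type f c)) (at 0)"
proof -
  define n where "n = (LEAST m. 0 < m \<and> (deriv ^^ m) f c \<noteq> 0)"
  have n: "0 < n" "(deriv ^^ n) f c \<noteq> 0"
    using LeastI[of "\<lambda>m. 0 < m \<and> (deriv ^^ m) f c \<noteq> 0" m] nz by (auto simp: n_def)
  have zero: "(deriv ^^ j) f c = 0" if "0 < j" "j < n" for j
    using not_less_Least[of j "\<lambda>m. 0 < m \<and> (deriv ^^ m) f c \<noteq> 0"] that by (auto simp: n_def)
  have lim: "((\<lambda>z. (f (c + z) - f c) / z ^ n) \<longlongrightarrow> (deriv ^^ n) f c / fact n) (at 0)"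
    by (rule taylor_leading_term[OF r deriv n(1) zero])
  from leading_term_at_maximum[OF lim _ max] n(2) obtain k where k: "n = 2 * k" "(deriv ^^ n) f c < 0"
    by (auto simp: divide_less_0_iff elim: evenE)
  have "has_type f c k"
    using k n zero by (auto simp: has_type_def)
  moreover from this have pt: "point_type f c = k"
    by (rule point_type_eq)
  ultimately show "has_type f c (point_type f c)"
    by simp
  show "((\<lambda>z. (f (c + z) - f c) / z ^ (2 * point_type f c))
      \<longlongrightarrow> point_strength f c / fact (2 * point_type f c)) (at 0)"
    using lim by (simp add: point_strength_def pt k)
qed

text \<open>Coercivity reduces everything to compact intervals. The gap in the last clause is
  uniform over the whole complement of \<open>S\<close>, which is what an exponential bound on the
  Laplace tail requires.\<close>

lemma global_max_points_coercive:
  fixes f :: "real \<Rightarrow> real"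
  assumes cont: "continuous_on UNIV f" and bot: "filterlim f at_bot at_infinity"
  shows "global_max_points f \<noteq> {}" "compact (global_max_points f)"
    and "\<And>S m. open S \<Longrightarrow> global_max_points f \<subseteq> S \<Longrightarrow> m \<in> global_max_points f \<Longrightarrow>
      \<exists>\<epsilon>>0. \<forall>x. x \<notin> S \<longrightarrow> f x \<le> f m - \<epsilon>"
proof -
  have bound: "\<exists>R. \<forall>x. R < \<bar>x\<bar> \<longrightarrow> f x < C" for C
  proof -
    have "\<forall>\<^sub>F x in at_infinity. f x < C"
      using bot unfolding filterlim_at_bot_dense by blast
    then obtain R where "\<And>x. R \<le> \<bar>x\<bar> \<Longrightarrow> f x < C"
      unfolding eventually_at_infinity by auto
    then show ?thesis
      by (intro exI[of _ R]) auto
  qed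
  obtain R0 where R0: "\<And>x. R0 < \<bar>x\<bar> \<Longrightarrow> f x < f 0"
    using bound by blast
  have "R0 \<ge> 0" using R0[of 0] by force
  then have "{- R0..R0} \<noteq> {}"
    by simp
  then obtain m where m: "\<And>x. x \<in> {- R0..R0} \<Longrightarrow> f x \<le> f m"
    using continuous_attains_sup[OF compact_Icc _ continuous_on_subset[OF cont subset_UNIV], of "- R0" R0] by blast
  have m_max: "f x \<le> f m" for x
  proof (cases "R0 < \<bar>x\<bar>")
    case True
    then show ?thesis using R0[OF True] m[of 0] \<open>R0 \<ge> 0\<close> by simp
  next
    case False
    then show ?thesis by (intro m) auto
  qed
  then have m_in: "m \<in> global_max_points f"
    by (simp add: global_max_points_def)
  then show "global_max_points f \<noteq> {}"
    by blast
  have eq: "global_max_points f = {x. f x = f m}"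
    using m_max by (auto simp: global_max_points_def antisym)
  have "closed (global_max_points f)"
    unfolding eq by (intro closed_Collect_eq cont continuous_on_const)
  moreover have "bounded (global_max_points f)"
    unfolding bounded_iff eq
  proof (intro exI ballI)
    fix x assume "x \<in> {x. f x = f m}"
    then show "norm x \<le> R0"
      using R0[of x] m_max[of 0] by (cases "R0 < \<bar>x\<bar>") auto
  qed
  ultimately show "compact (global_max_points f)"
    by (simp add: compact_eq_bounded_closed)
  fix S m' assume S: "open S" "global_max_points f \<subseteq> S" and "m' \<in> global_max_points f"
  then have m': "f m' = f m"
    by (simp add: eq)
  obtain R where R: "\<And>x. R < \<bar>x\<bar> \<Longrightarrow> f x < f m - 1"
    using bound by blast
  \<comment> \<open>Only the compact part \<open>T\<close> of the complement needs the extreme value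
    theorem; beyond \<open>R\<close> the values already lie more than 1 below the maximum. Hence the
    witness \<open>min 1 (f m - f y)\<close>.\<close>
  define T where "T = {- R..R} - S"
  have far: "f x \<le> f m - 1" if "x \<notin> S" "x \<notin> T" for x
  proof -
    have "R < \<bar>x\<bar>"
      using that by (auto simp: T_def)
    then show ?thesis
      using R[of x] by simp
  qed
  show "\<exists>\<epsilon>>0. \<forall>x. x \<notin> S \<longrightarrow> f x \<le> f m' - \<epsilon>"
  proof (cases "T = {}")
    case True
    then show ?thesis
      using far m' by (intro exI[of _ 1]) auto
  next
    case False
    have "compact T"
      unfolding T_def using S(1) by (intro compact_diff) auto
    then obtain y where y: "y \<in> T" "\<And>x. x \<in> T \<Longrightarrow> f x \<le> f y"
      using continuous_attains_sup[OF _ False continuous_on_subset[OF cont subset_UNIV]] by blast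
    have "y \<notin> global_max_points f"
      using y(1) S(2) by (auto simp: T_def)
    then have "f y < f m"
      using m_max[of y] by (auto simp: eq)
    then show ?thesis
      using far y(2) m' by (intro exI[of _ "min 1 (f m - f y)"]) fastforce
  qed
qed

text \<open>The leading Taylor term makes every maximum point isolated.\<close>

lemma finite_global_max_points:
  fixes f :: "real \<Rightarrow> real"
  assumes cpt: "compact (global_max_points f)"
    and expan: "\<And>p. p \<in> global_max_points f \<Longrightarrow>
      \<exists>n L. L \<noteq> 0 \<and> ((\<lambda>z. (f (p + z) - f p) / z ^ n) \<longlongrightarrow> L) (at 0)"
  shows "finite (global_max_points f)"
proof (rule ccontr)
  assume "infinite (global_max_points f)"
  then obtain p where p: "p \<in> global_max_points f" "p islimpt global_max_points f"
    using Heine_Borel_imp_Bolzano_Weierstrass[OF cpt _ order_refl] by blast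
  obtain n L where L: "L \<noteq> 0" "((\<lambda>z. (f (p + z) - f p) / z ^ n) \<longlongrightarrow> L) (at 0)"
    using expan[OF p(1)] by blast
  have "\<forall>\<^sub>F z in at 0. (f (p + z) - f p) / z ^ n \<noteq> 0"
    by (rule tendsto_imp_eventually_ne[OF L(2,1)])
  then obtain d where d: "0 < d" "\<And>z. z \<noteq> 0 \<Longrightarrow> \<bar>z\<bar> < d \<Longrightarrow> f (p + z) \<noteq> f p"
    unfolding eventually_at by (auto simp: dist_real_def)
  obtain q where q: "q \<in> global_max_points f" "q \<noteq> p" "dist q p < d"
    using p(2) d(1) unfolding islimpt_approachable by blast
  then have "f q = f p"
    using p(1) by (auto simp: global_max_points_def intro: antisym)
  then show False
    using d(2)[of "q - p"] q by (simp add: dist_real_def)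
qed

section \<open>Curie-Weiss model: analyticity, decay and types of \<open>fCW\<close>\<close>

locale cw_model = prob_space \<rho> for \<rho> :: "real measure" +
  fixes J h :: real
  assumes sets_rho [simp, measurable_cong]: "sets \<rho> = sets borel"
    and integrable_gauss: "\<And>a b. 0 < a \<Longrightarrow> integrable \<rho> (\<lambda>x. exp (a * x\<^sup>2 / 2 + b * x))"
    and J_pos: "0 < J"
begin

abbreviation f :: "real \<Rightarrow> real" where "f \<equiv> fCW \<rho> J h"

text \<open>The two-sided Laplace transform of \<open>\<rho>\<close>, taken at complex arguments so
  that analytic continuation is available.\<close>

definition mgf :: "complex \<Rightarrow> complex" where
  "mgf z = (\<integral>s. exp (z * of_real s) \<partial>\<rho>)"

lemma integrable_exp_linear: "integrable \<rho> (\<lambda>s. exp (s * b))"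
  by (rule Bochner_Integration.integrable_bound[OF integrable_gauss[of 1 b]]) (auto simp: mult.commute)

text \<open>With \<open>c = norm z\<close> this dominates every partial sum of the exponential
  series of \<open>z * s\<close>.\<close>

lemma integrable_exp_abs: "integrable \<rho> (\<lambda>s. exp (c * \<bar>s\<bar>))"
proof (rule Bochner_Integration.integrable_bound)
  show "integrable \<rho> (\<lambda>s. exp (s * c) + exp (s * (- c)))"
    by (intro Bochner_Integration.integrable_add integrable_exp_linear)
  show "AE s in \<rho>. norm (exp (c * \<bar>s\<bar>)) \<le> norm (exp (s * c) + exp (s * (- c)))"
  proof (rule AE_I2)
    fix s
    have "exp (c * \<bar>s\<bar>) \<le> exp (s * c) + exp (s * (- c))"
      by (cases "s < 0") (simp_all add: mult.commute)
    then show "norm (exp (c * \<bar>s\<bar>)) \<le> norm (exp (s * c) + exp (s * (- c)))"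
      unfolding real_norm_def abs_exp_cancel by (rule order_trans[OF _ abs_ge_self])
  qed
qed simp

text \<open>Dominated convergence interchanges series and integral. Convergence at every
  \<open>z\<close> is the point: it makes \<open>mgf\<close> entire.\<close>

lemma mgf_sums: "(\<lambda>n. (\<integral>s. of_real (s ^ n) / fact n \<partial>\<rho>) * z ^ n) sums mgf z"
proof -
  have term_bound: "norm ((z * of_real s) ^ i / fact i) = (norm z * \<bar>s\<bar>) ^ i / fact i" for s i
    by (simp add: norm_divide norm_power norm_mult)
  have part_bound: "(\<Sum>i<n. (norm z * \<bar>s\<bar>) ^ i / fact i) \<le> exp (norm z * \<bar>s\<bar>)" for s n
    using exp_converges[of "norm z * \<bar>s\<bar>"]
    by (intro sum_le_suminf[THEN order_trans, OF sums_summable])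
      (auto simp: sums_iff divide_inverse mult.commute)
  have int: "integrable \<rho> (\<lambda>s. (z * of_real s) ^ i / fact i)" for i
  proof (rule Bochner_Integration.integrable_bound[OF integrable_exp_abs[of "norm z"]])
    show "AE s in \<rho>. norm ((z * of_real s) ^ i / fact i) \<le> norm (exp (norm z * \<bar>s\<bar>))"
    proof (rule AE_I2)
      fix s
      have "(norm z * \<bar>s\<bar>) ^ i / fact i \<le> (\<Sum>j<Suc i. (norm z * \<bar>s\<bar>) ^ j / fact j)"
        by (intro member_le_sum) auto
      then show "norm ((z * of_real s) ^ i / fact i) \<le> norm (exp (norm z * \<bar>s\<bar>))"
        unfolding term_bound using part_bound[of s "Suc i"] by simp
    qed
  qed simp
  have "(\<lambda>n. \<integral>s. (\<Sum>i<n. (z * of_real s) ^ i / fact i) \<partial>\<rho>) \<longlonglongrightarrow> mgf z"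
    unfolding mgf_def
  proof (rule integral_dominated_convergence[OF _ _ integrable_exp_abs[of "norm z"]])
    show "AE s in \<rho>. (\<lambda>n. \<Sum>i<n. (z * of_real s) ^ i / fact i) \<longlonglongrightarrow> exp (z * of_real s)"
      using exp_converges[where 'a = complex] by (auto simp: sums_def scaleR_conv_of_real divide_inverse mult.commute)
    show "AE s in \<rho>. norm (\<Sum>i<n. (z * of_real s) ^ i / fact i) \<le> exp (norm z * \<bar>s\<bar>)" for n
    proof (rule AE_I2)
      fix s
      have "norm (\<Sum>i<n. (z * of_real s) ^ i / fact i) \<le> (\<Sum>i<n. norm ((z * of_real s) ^ i / fact i))"
        by (rule norm_sum)
      then show "norm (\<Sum>i<n. (z * of_real s) ^ i / fact i) \<le> exp (norm z * \<bar>s\<bar>)"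
        unfolding term_bound using part_bound[of s n] by simp
    qed
  qed auto
  moreover have "(\<integral>s. (\<Sum>i<n. (z * of_real s) ^ i / fact i) \<partial>\<rho>)
      = (\<Sum>i<n. (\<integral>s. of_real (s ^ i) / fact i \<partial>\<rho>) * z ^ i)" for n
    using int by (simp add: Bochner_Integration.integral_sum power_mult_distrib mult.commute
        flip: integral_mult_right_zero)
  ultimately show ?thesis
    by (simp add: sums_def)
qed

lemma holomorphic_mgf: "mgf holomorphic_on S"
proof -
  have "mgf holomorphic_on ball 0 r" for r
  proof (rule power_series_holomorphic)
    show "(\<lambda>n. (\<integral>s. of_real (s ^ n) / fact n \<partial>\<rho>) * (w - 0) ^ n) sums mgf w" for w
      using mgf_sums[of w] by (simp only: diff_zero)
  qed
  then have "mgf holomorphic_on (\<Union>r. ball 0 r)"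
    by (intro holomorphic_on_UN_open) auto
  moreover have "(\<Union>r. ball (0::complex) r) = UNIV"
    by (auto simp: intro: gt_ex)
  ultimately show ?thesis
    by (metis holomorphic_on_subset subset_UNIV)
qed

lemma mgf_of_real: "mgf (of_real t) = of_real (\<integral>s. exp (s * t) \<partial>\<rho>)"
proof -
  have "exp (of_real t * of_real s) = complex_of_real (exp (s * t))" for s
    by (simp add: mult.commute flip: exp_of_real)
  then show ?thesis
    unfolding mgf_def by simp
qed

text \<open>Ensures that the \<open>ln\<close> in \<open>fCW\<close> is a true logarithm and not a
  default value.\<close>

lemma mgf_real_pos: "0 < (\<integral>s. exp (s * t) \<partial>\<rho>)"
proof -
  have "(\<integral>s. exp (s * t) \<partial>\<rho>) \<noteq> 0"
    using integral_nonneg_eq_0_iff_AE[OF integrable_exp_linear[of t]] by simp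
  then show ?thesis
    by (simp add: order_less_le)
qed

lemma exp_fCW: "exp (f x) = exp (- J / 2 * x\<^sup>2) * (\<integral>s. exp (s * (J * x + h)) \<partial>\<rho>)"
  unfolding fCW_def exp_add by (simp add: mgf_real_pos)

lemma fCW_at_bot: "filterlim f at_bot at_infinity"
proof -
  define D where "D = (\<integral>s. exp (J * s\<^sup>2) \<partial>\<rho>)"
  have intD: "integrable \<rho> (\<lambda>s. exp (J * s\<^sup>2))"
    using integrable_gauss[of "2 * J" 0] J_pos by simp
  have upper: "f x \<le> - J / 2 * x\<^sup>2 + (J * x + h)\<^sup>2 / (4 * J) + ln D" for x
  proof -
    \<comment> \<open>Young's inequality. With \<open>t = J * x + h\<close> the first term grows
      like \<open>J / 4 * x\<^sup>2\<close>, only half of the negative quadratic in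
      \<open>f\<close>; the price \<open>exp (J * s\<^sup>2)\<close> is covered by
      \<open>integrable_gauss\<close> with \<open>a = 2 * J\<close>.\<close>
    have "s * t \<le> t\<^sup>2 / (4 * J) + J * s\<^sup>2" for s t
      using J_pos zero_le_power2[of "2 * J * s - t"] by (simp add: field_simps power2_eq_square)
    then have "exp (s * (J * x + h)) \<le> exp ((J * x + h)\<^sup>2 / (4 * J)) * exp (J * s\<^sup>2)" for s
      by (simp flip: exp_add)
    then have le: "(\<integral>s. exp (s * (J * x + h)) \<partial>\<rho>) \<le> exp ((J * x + h)\<^sup>2 / (4 * J)) * D"
      unfolding D_def integral_mult_right_zero[symmetric]
      by (intro integral_mono integrable_exp_linear integrable_mult_right intD)
    then have D: "0 < D"
      using order_less_le_trans[OF mgf_real_pos le] by (simp add: zero_less_mult_iff)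
    have "ln (\<integral>s. exp (s * (J * x + h)) \<partial>\<rho>) \<le> ln (exp ((J * x + h)\<^sup>2 / (4 * J)) * D)"
      using le mgf_real_pos D by simp
    then show ?thesis
      using D by (simp add: fCW_def ln_mult)
  qed
  have "filterlim (\<lambda>x. - J / 2 * x\<^sup>2 + (J * x + h)\<^sup>2 / (4 * J) + ln D) at_bot F"
    if "F = at_top \<or> F = at_bot" for F :: "real filter"
    using that
  proof
    have eq: "(\<lambda>x. - J / 2 * x\<^sup>2 + (J * x + h)\<^sup>2 / (4 * J) + ln D)
      = (\<lambda>x. - (J / 4) * x\<^sup>2 + (h / 2) * x + (h\<^sup>2 / (4 * J) + ln D))"
      using J_pos by (auto simp: fun_eq_iff field_simps power2_eq_square)
    { fix b C a :: real assume "0 < a"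
      then have "filterlim (\<lambda>x. - a * x\<^sup>2 + b * x + C) at_bot at_top"
        "filterlim (\<lambda>x. - a * x\<^sup>2 + b * x + C) at_bot at_bot"
        by real_asymp+ }
    note * = this
    show "filterlim (\<lambda>x. - J / 2 * x\<^sup>2 + (J * x + h)\<^sup>2 / (4 * J) + ln D) at_bot F" if "F = at_top"
      unfolding that eq by (intro *) (use J_pos in simp)
    show "filterlim (\<lambda>x. - J / 2 * x\<^sup>2 + (J * x + h)\<^sup>2 / (4 * J) + ln D) at_bot F" if "F = at_bot"
      unfolding that eq by (intro *) (use J_pos in simp)
  qed
  then have "filterlim (\<lambda>x. - J / 2 * x\<^sup>2 + (J * x + h)\<^sup>2 / (4 * J) + ln D) at_bot at_infinity"
    by (simp add: at_infinity_eq_at_top_bot filterlim_sup)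
  then show ?thesis
    by (rule filterlim_at_bot_mono) (intro always_eventually allI upper)
qed

text \<open>On the real line the transform is positive, so nearby it stays in the right half-plane,
  where the principal logarithm is holomorphic. The last clause ties the local \<open>g\<close> to
  an entire function, which is what allows continuation beyond the ball.\<close>

lemma fCW_complex_extension:
  obtains g r where "0 < r" "g holomorphic_on ball (of_real \<mu>) r"
    "\<And>x. \<bar>x - \<mu>\<bar> < r \<Longrightarrow> g (of_real x) = of_real (f x)"
    "\<And>z. z \<in> ball (of_real \<mu>) r \<Longrightarrow> exp (g z) = mgf (of_real J * z + of_real h) * exp (- of_real (J / 2) * z\<^sup>2)"
proof -
  define \<Phi> where "\<Phi> z = mgf (of_real J * z + of_real h)" for z
  have hol: "\<Phi> holomorphic_on S" for S
    unfolding \<Phi>_def by (rule holomorphic_on_compose_gen[OF _ holomorphic_mgf[of UNIV], unfolded o_def])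
      (auto intro!: holomorphic_intros)
  have real: "\<Phi> (of_real x) = of_real (\<integral>s. exp (s * (J * x + h)) \<partial>\<rho>)" for x
    unfolding \<Phi>_def mgf_of_real[symmetric] by simp
  have "open {z. 0 < Re (\<Phi> z)}"
    using holomorphic_on_imp_continuous_on[OF hol[of UNIV]]
    by (intro open_Collect_less continuous_intros)
  moreover have "of_real \<mu> \<in> {z. 0 < Re (\<Phi> z)}"
    using mgf_real_pos by (simp add: real)
  ultimately obtain r where r: "0 < r" "ball (of_real \<mu>) r \<subseteq> {z. 0 < Re (\<Phi> z)}"
    by (rule openE)
  define g where "g z = Ln (\<Phi> z) - of_real (J / 2) * z\<^sup>2" for z
  have nz: "\<Phi> z \<notin> \<real>\<^sub>\<le>\<^sub>0" if "z \<in> ball (of_real \<mu>) r" for z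
    using r(2) that by (auto simp: complex_nonpos_Reals_iff)
  show ?thesis
  proof (rule that[OF r(1)])
    show "g holomorphic_on ball (of_real \<mu>) r"
      unfolding g_def using nz by (intro holomorphic_intros hol) auto
    show "g (of_real x) = of_real (f x)" for x
      by (simp add: g_def real fCW_def Ln_of_real mgf_real_pos)
    show "exp (g z) = mgf (of_real J * z + of_real h) * exp (- of_real (J / 2) * z\<^sup>2)"
      if "z \<in> ball (of_real \<mu>) r" for z
    proof -
      have "\<Phi> z \<noteq> 0" using nz[OF that] by auto
      then have "exp (g z) = \<Phi> z / exp (of_real (J / 2) * z\<^sup>2)"
        unfolding g_def exp_diff by (subst exp_Ln) simp_all
      moreover have "exp (- of_real (J / 2) * z\<^sup>2) = inverse (exp (of_real (J / 2) * z\<^sup>2))"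
        by (simp only: mult_minus_left exp_minus)
      ultimately show ?thesis
        by (simp only: \<Phi>_def divide_inverse)
    qed
  qed
qed

lemma fCW_higher_deriv:
  obtains r where "0 < r"
    "\<And>m x. \<bar>x - \<mu>\<bar> < r \<Longrightarrow> ((deriv ^^ m) f has_real_derivative (deriv ^^ Suc m) f x) (at x)"
proof -
  obtain g r where "0 < r" "g holomorphic_on ball (of_real \<mu>) r"
    "\<And>x. \<bar>x - \<mu>\<bar> < r \<Longrightarrow> g (of_real x) = of_real (f x)"
    using fCW_complex_extension[of \<mu>] by metis
  then show ?thesis
    using that real_higher_deriv_of_holomorphic(2) by blast
qed

lemma continuous_fCW: "continuous_on UNIV f"
proof -
  have "isCont f x" for x
  proof -
    obtain r where "0 < r" "\<And>m y. \<bar>y - x\<bar> < r \<Longrightarrow> ((deriv ^^ m) f has_real_derivative (deriv ^^ Suc m) f y) (at y)"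
      using fCW_higher_deriv[of x] by metis
    from this(2)[of x 0] this(1) show ?thesis
      by (auto intro: DERIV_isCont)
  qed
  then show ?thesis
    by (simp add: continuous_on_eq_continuous_at)
qed

text \<open>If all derivatives vanished at \<open>\<mu>\<close>, the entire function extending \<open>exp f\<close> would be
  constant, contradicting the decay of \<open>f\<close>.\<close>

lemma fCW_nonvanishing_deriv: "\<exists>m>0. (deriv ^^ m) f \<mu> \<noteq> 0"
proof (rule ccontr)
  assume "\<not> (\<exists>m>0. (deriv ^^ m) f \<mu> \<noteq> 0)"
  then have zero: "(deriv ^^ m) f \<mu> = 0" if "0 < m" for m
    using that by blast
  obtain g r where g: "0 < r" "g holomorphic_on ball (of_real \<mu>) r"
    "\<And>x. \<bar>x - \<mu>\<bar> < r \<Longrightarrow> g (of_real x) = of_real (f x)"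
    "\<And>z. z \<in> ball (of_real \<mu>) r \<Longrightarrow> exp (g z) = mgf (of_real J * z + of_real h) * exp (- of_real (J / 2) * z\<^sup>2)"
    using fCW_complex_extension[of \<mu>] by metis
  have "(deriv ^^ m) g (of_real \<mu>) = 0" if "0 < m" for m
    using real_higher_deriv_of_holomorphic(1)[OF g(2,3), of \<mu> m] g(1) zero[OF that] by simp
  then have const: "g z = g (of_real \<mu>)" if "z \<in> ball (of_real \<mu>) r" for z
    using g(1) that by (intro holomorphic_fun_eq_const_on_connected[OF g(2)]) auto
  \<comment> \<open>\<open>g\<close> lives only on the ball, but its exponential agrees there with
    the entire \<open>F\<close>, so constancy on the ball spreads to the plane.\<close>
  define F where "F z = mgf (of_real J * z + of_real h) * exp (- of_real (J / 2) * z\<^sup>2)" for z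
  have "(\<lambda>z. mgf (of_real J * z + of_real h)) holomorphic_on UNIV"
    by (rule holomorphic_on_compose_gen[OF _ holomorphic_mgf[of UNIV], unfolded o_def])
      (auto intro!: holomorphic_intros)
  then have hol: "F holomorphic_on UNIV"
    unfolding F_def by (intro holomorphic_intros)
  have F_const: "F z = exp (g (of_real \<mu>))" for z
  proof (rule analytic_continuation_open[of "ball (of_real \<mu>) r" UNIV F "\<lambda>_. exp (g (of_real \<mu>))"])
    show "F z = exp (g (of_real \<mu>))" if "z \<in> ball (of_real \<mu>) r" for z
      using g(4)[OF that] const[OF that] by (simp only: F_def)
    show "ball (complex_of_real \<mu>) r \<noteq> {}"
      using g(1) by simp
  qed (use hol connected_UNIV in simp_all)
  have F_real: "F (of_real x) = of_real (exp (f x))" for x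
  proof -
    have "mgf (of_real J * of_real x + of_real h) = of_real (\<integral>s. exp (s * (J * x + h)) \<partial>\<rho>)"
      unfolding mgf_of_real[symmetric] by simp
    then show ?thesis
      unfolding F_def exp_fCW by (simp add: mult.commute flip: exp_of_real)
  qed
  have "f x = f \<mu>" for x
  proof -
    have "complex_of_real (exp (f x)) = complex_of_real (exp (f \<mu>))"
      unfolding F_real[symmetric] F_const ..
    then show ?thesis
      by (metis exp_inj_iff of_real_eq_iff)
  qed
  moreover have "\<forall>\<^sub>F x in at_infinity. f x < f \<mu>"
    using fCW_at_bot unfolding filterlim_at_bot_dense by blast
  then have "\<exists>x. f x < f \<mu>"
    using eventually_happens trivial_limit_at_infinity by blast
  ultimately show False
    by (metis order_less_irrefl)
qed

lemma fCW_type: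
  assumes "\<mu> \<in> global_max_points f"
  shows "has_type f \<mu> (point_type f \<mu>)"
    and "((\<lambda>z. (f (\<mu> + z) - f \<mu>) / z ^ (2 * point_type f \<mu>))
      \<longlongrightarrow> point_strength f \<mu> / fact (2 * point_type f \<mu>)) (at 0)"
    and "1 \<le> point_type f \<mu>" "point_strength f \<mu> < 0"
proof -
  obtain r where r: "0 < r"
    "\<And>m x. \<bar>x - \<mu>\<bar> < r \<Longrightarrow> ((deriv ^^ m) f has_real_derivative (deriv ^^ Suc m) f x) (at x)"
    using fCW_higher_deriv[of \<mu>] by metis
  obtain m where m: "0 < m" "(deriv ^^ m) f \<mu> \<noteq> 0"
    using fCW_nonvanishing_deriv by blast
  have max: "\<And>x. f x \<le> f \<mu>"
    using assms by (simp add: global_max_points_def)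
  show type: "has_type f \<mu> (point_type f \<mu>)"
    and "((\<lambda>z. (f (\<mu> + z) - f \<mu>) / z ^ (2 * point_type f \<mu>))
      \<longlongrightarrow> point_strength f \<mu> / fact (2 * point_type f \<mu>)) (at 0)"
    using has_type_of_nonvanishing_deriv[OF r m max] by blast+
  from type show "1 \<le> point_type f \<mu>" "point_strength f \<mu> < 0"
    by (auto simp: has_type_def point_strength_def)
qed

lemma finite_max_points: "finite (global_max_points f)"
proof (rule finite_global_max_points)
  show "compact (global_max_points f)"
    by (rule global_max_points_coercive(2)[OF continuous_fCW fCW_at_bot])
  show "\<exists>n L. L \<noteq> 0 \<and> ((\<lambda>z. (f (p + z) - f p) / z ^ n) \<longlongrightarrow> L) (at 0)"
    if "p \<in> global_max_points f" for p
  proof (intro exI conjI)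
    show "point_strength f p / fact (2 * point_type f p) \<noteq> 0"
      using fCW_type(4)[OF that] by simp
  qed (rule fCW_type(2)[OF that])
qed

end

subsection \<open>Laplace's method\<close>

text \<open>The number of spins is \<open>Suc n\<close> in the asymptotics; kept whole,
  \<open>real (Suc n)\<close> retains its shape under \<open>powr\<close>.\<close>

declare of_nat_Suc [simp del]

text \<open>Equals \<open>Gamma (1 / (2 * K)) / K\<close> for \<open>K \<ge> 1\<close>. As a factor
  common to all points of maximal type it cancels in the limit law.\<close>

definition exp_power_integral :: "nat \<Rightarrow> real" where
  "exp_power_integral K = (\<integral>y. exp (- (y ^ (2 * K))) \<partial>lborel)"

lemma power2_le_one_plus_even_power:
  fixes y :: real
  assumes "1 \<le> K"
  shows "y\<^sup>2 \<le> 1 + y ^ (2 * K)"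
proof (cases "\<bar>y\<bar> \<le> 1")
  case True
  then have "y\<^sup>2 \<le> 1"
    by (simp add: abs_square_le_1)
  then show ?thesis
    by (simp add: power_mult add_increasing2)
next
  case False
  then have "1 \<le> \<bar>y\<bar>\<^sup>2"
    by (intro one_le_power) simp
  then have "1 \<le> y\<^sup>2"
    by simp
  then have "(y\<^sup>2) ^ 1 \<le> (y\<^sup>2) ^ K"
    using assms by (rule power_increasing[rotated])
  then show ?thesis
    by (simp add: power_mult)
qed

text \<open>Since \<open>y\<^sup>2 \<le> 1 + y ^ (2 * K)\<close>, the integrand is at most
  \<open>exp a\<close> times a Gaussian.\<close>

lemma integrable_exp_even_power:
  fixes a :: real
  assumes "0 < a" "1 \<le> K"
  shows "integrable lborel (\<lambda>y. exp (- a * y ^ (2 * K)))"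
proof (rule Bochner_Integration.integrable_bound)
  \<comment> \<open>The standard deviation for which \<open>exp (- a * y\<^sup>2)\<close> is an
    unnormalised normal density.\<close>
  define s where "s = 1 / sqrt (2 * a)"
  have s: "0 < s" "2 * s\<^sup>2 = 1 / a"
    using assms by (auto simp: s_def power_divide)
  have "exp (a - a * y\<^sup>2) = (exp a * sqrt (2 * pi * s\<^sup>2)) * normal_density 0 s y" for y
    using assms s by (simp add: normal_density_def exp_diff exp_minus field_simps)
  then show "integrable lborel (\<lambda>y. exp (a - a * y\<^sup>2))"
    using s by simp
  have "- a * y ^ (2 * K) \<le> a - a * y\<^sup>2" for y
    using mult_left_mono[OF power2_le_one_plus_even_power[OF assms(2), of y], of a] assms(1)
    by (simp add: algebra_simps)
  then show "AE y in lborel. norm (exp (- a * y ^ (2 * K))) \<le> norm (exp (a - a * y\<^sup>2))"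
    by simp
qed simp

text \<open>Scaling \<open>y\<close> by \<open>a powr (1 / (2 * K))\<close>; this is where the
  exponent of the limiting weights arises.\<close>

lemma integral_exp_even_power:
  fixes a :: real
  assumes "0 < a" "1 \<le> K"
  shows "(\<integral>y. exp (- a * y ^ (2 * K)) \<partial>lborel)
    = a powr (- 1 / (2 * real K)) * exp_power_integral K"
proof -
  define c where "c = a powr (1 / (2 * real K))"
  have c: "c \<noteq> 0" "0 < c" "c ^ (2 * K) = a"
    using assms by (auto simp: c_def powr_powr simp flip: powr_realpow)
  have "exp_power_integral K = c * (\<integral>y. exp (- a * y ^ (2 * K)) \<partial>lborel)"
    unfolding exp_power_integral_def
    by (subst lborel_integral_real_affine[OF c(1), where t = 0])
      (use c in \<open>simp add: power_mult_distrib\<close>)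
  moreover have "a powr (- 1 / (2 * real K)) * c = 1"
    using assms by (simp add: c_def flip: powr_add)
  ultimately show ?thesis
    by (metis mult.assoc mult.left_neutral)
qed

lemma exp_power_integral_pos:
  assumes "1 \<le> K"
  shows "0 < exp_power_integral K"
proof -
  have int: "integrable lborel (\<lambda>y::real. exp (- (y ^ (2 * K))))"
    using integrable_exp_even_power[of 1 K] assms by simp
  have "exp_power_integral K \<noteq> 0"
  proof
    assume "exp_power_integral K = 0"
    then have "AE y in lborel. exp (- ((y::real) ^ (2 * K))) = 0"
      unfolding exp_power_integral_def using int by (subst (asm) integral_nonneg_eq_0_iff_AE) auto
    then show False
      by (simp add: eventually_False ae_filter_eq_bot_iff)
  qed
  moreover have "0 \<le> exp_power_integral K"
    unfolding exp_power_integral_def by simp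
  ultimately show ?thesis
    by simp
qed

text \<open>With \<open>n + 1\<close> in the role of \<open>N\<close>, substituting \<open>x = \<mu> + N powr (- 1 / (2 * K)) * y\<close> turns the
  integrand near a maximum point of type \<open>k \<le> K\<close> into one dominated by a multiple of
  \<open>exp (- a / 2 * y ^ (2 * K))\<close>.  Normalising with the larger type \<open>K\<close>
  kills the maximum points with \<open>k < K\<close>.\<close>

lemma laplace_local:
  fixes f :: "real \<Rightarrow> real" and \<phi> :: "real \<Rightarrow> complex"
  assumes [measurable]: "f \<in> borel_measurable borel" "\<phi> \<in> borel_measurable borel"
    and cont: "isCont \<phi> \<mu>" and bound: "\<And>x. norm (\<phi> x) \<le> B"
    and expan: "((\<lambda>z. (f (\<mu> + z) - f \<mu>) / z ^ (2 * k)) \<longlongrightarrow> - a) (at 0)"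
    and a: "0 < a" and k: "1 \<le> k" "k \<le> K"
  shows "\<exists>d>0. \<forall>\<delta>. 0 < \<delta> \<and> \<delta> \<le> d \<longrightarrow>
    (\<lambda>n. real (Suc n) powr (1 / (2 * real K)) *\<^sub>R
       (\<integral>x. indicator (ball \<mu> \<delta>) x *\<^sub>R exp (real (Suc n) * (f x - f \<mu>)) *\<^sub>R \<phi> x \<partial>lborel))
    \<longlonglongrightarrow> (if k = K then (a powr (- 1 / (2 * real K)) * exp_power_integral K) *\<^sub>R \<phi> \<mu> else 0)"
proof -
  have K: "1 \<le> K" using k by simp
  have "\<forall>\<^sub>F z in at 0. (f (\<mu> + z) - f \<mu>) / z ^ (2 * k) < - a / 2"
    by (rule order_tendstoD(2)[OF expan]) (use a in auto)
  then obtain d0 where d0: "0 < d0"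
      "\<And>z. z \<noteq> 0 \<Longrightarrow> \<bar>z\<bar> < d0 \<Longrightarrow> (f (\<mu> + z) - f \<mu>) / z ^ (2 * k) < - a / 2"
    unfolding eventually_at by (auto simp: dist_real_def)
  \<comment> \<open>A radius of at most 1 makes \<open>z ^ (2 * K) \<le> z ^ (2 * k)\<close>, so one
    bound of order \<open>2 * K\<close> serves every type \<open>k \<le> K\<close>.\<close>
  define d where "d = min d0 1"
  have upper: "f (\<mu> + z) - f \<mu> \<le> - (a / 2) * z ^ (2 * K)" if "\<bar>z\<bar> < d" for z
  proof (cases "z = 0")
    case True
    then show ?thesis using K by (simp add: power_0_left)
  next
    case False
    have pos: "0 < z ^ (2 * k)"
      using False by (simp add: zero_less_power_eq)
    have "f (\<mu> + z) - f \<mu> \<le> - (a / 2) * z ^ (2 * k)"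
      using d0(2)[OF False] that pos by (simp add: d_def field_simps)
    moreover have "(z\<^sup>2) ^ K \<le> (z\<^sup>2) ^ k"
      using k that by (intro power_decreasing) (auto simp: d_def abs_square_le_1)
    then have "(a / 2) * z ^ (2 * K) \<le> (a / 2) * z ^ (2 * k)"
      using a by (intro mult_left_mono) (auto simp: power_mult)
    ultimately show ?thesis
      by simp
  qed
  have B: "0 \<le> B"
    using bound[of 0] norm_ge_zero order_trans by blast
  define c where "c n = real (Suc n) powr (- 1 / (2 * real K))" for n
  have c_pos: "0 < c n" for n
    by (simp add: c_def)
  have c_inv: "real (Suc n) powr (1 / (2 * real K)) = inverse (c n)" for n
    by (simp add: c_def flip: powr_minus)
  \<comment> \<open>For \<open>j = K\<close> the power of \<open>N\<close> disappears, which gives a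
    dominating function independent of \<open>n\<close>; for \<open>j = k < K\<close> it diverges
    and drives the integrand to 0.\<close>
  have c_pow: "real (Suc n) * (c n * y) ^ (2 * j) = real (Suc n) powr (1 - real j / real K) * y ^ (2 * j)"
    for n y j
  proof -
    have "c n ^ (2 * j) = real (Suc n) powr (- real j / real K)"
      using K by (simp add: c_def powr_powr field_simps flip: powr_realpow)
    moreover have "real (Suc n) * real (Suc n) powr (- real j / real K) = real (Suc n) powr (1 - real j / real K)"
      using powr_add[of "real (Suc n)" 1 "- real j / real K"] by simp
    ultimately show ?thesis
      by (simp add: power_mult_distrib)
  qed
  have c_lim: "c \<longlonglongrightarrow> 0"
  proof -
    have "0 < 1 / (2 * real K)" using K by simp
    then have "(\<lambda>n. real (Suc n) powr (- (1 / (2 * real K)))) \<longlonglongrightarrow> 0"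
      by real_asymp
    then show ?thesis by (simp add: c_def[abs_def])
  qed
  have main: "(\<lambda>n. real (Suc n) powr (1 / (2 * real K)) *\<^sub>R
       (\<integral>x. indicator (ball \<mu> \<delta>) x *\<^sub>R exp (real (Suc n) * (f x - f \<mu>)) *\<^sub>R \<phi> x \<partial>lborel))
    \<longlonglongrightarrow> (if k = K then (a powr (- 1 / (2 * real K)) * exp_power_integral K) *\<^sub>R \<phi> \<mu> else 0)"
    if \<delta>: "0 < \<delta>" "\<delta> \<le> d" for \<delta>
  proof -
    define u where "u n y = indicator (ball \<mu> \<delta>) (\<mu> + c n * y) *\<^sub>R
      exp (real (Suc n) * (f (\<mu> + c n * y) - f \<mu>)) *\<^sub>R \<phi> (\<mu> + c n * y)" for n y
    define v where "v y = (if k = K then exp (- a * y ^ (2 * K)) *\<^sub>R \<phi> \<mu> else 0)" for y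
    have eq: "real (Suc n) powr (1 / (2 * real K)) *\<^sub>R
       (\<integral>x. indicator (ball \<mu> \<delta>) x *\<^sub>R exp (real (Suc n) * (f x - f \<mu>)) *\<^sub>R \<phi> x \<partial>lborel)
      = (\<integral>y. u n y \<partial>lborel)" for n
      unfolding u_def using c_pos[of n]
      by (subst lborel_integral_real_affine[where c = "c n" and t = \<mu>]) (auto simp: c_inv)
    have "(\<lambda>n. \<integral>y. u n y \<partial>lborel) \<longlonglongrightarrow> (\<integral>y. v y \<partial>lborel)"
    proof (rule integral_dominated_convergence)
      show "v \<in> borel_measurable lborel"
        unfolding v_def by (cases "k = K") simp_all
      show "u n \<in> borel_measurable lborel" for n
      proof -
        have "(\<lambda>x. indicator (ball \<mu> \<delta>) x *\<^sub>R exp (real (Suc n) * (f x - f \<mu>)) *\<^sub>R \<phi> x)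
            \<in> borel_measurable borel"
          by (intro borel_measurable_scaleR borel_measurable_indicator) auto
        moreover have "(\<lambda>y. \<mu> + c n * y) \<in> borel_measurable lborel"
          by simp
        ultimately show ?thesis
          unfolding u_def by (rule measurable_compose[rotated])
      qed
      show "integrable lborel (\<lambda>y. B * exp (- (a / 2) * y ^ (2 * K)))"
        using a K by (intro integrable_mult_right integrable_exp_even_power) auto
      show "AE y in lborel. norm (u n y) \<le> B * exp (- (a / 2) * y ^ (2 * K))" for n
      proof (rule AE_I2)
        fix y
        show "norm (u n y) \<le> B * exp (- (a / 2) * y ^ (2 * K))"
        proof (cases "\<bar>c n * y\<bar> < \<delta>")
          case True
          have "real (Suc n) * (f (\<mu> + c n * y) - f \<mu>) \<le> real (Suc n) * (- (a / 2) * (c n * y) ^ (2 * K))"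
            using True \<delta> by (intro mult_left_mono upper) auto
          also have "\<dots> = - (a / 2) * (real (Suc n) * (c n * y) ^ (2 * K))"
            by (simp add: algebra_simps)
          also have "\<dots> = - (a / 2) * y ^ (2 * K)"
            unfolding c_pow using K by simp
          finally have "exp (real (Suc n) * (f (\<mu> + c n * y) - f \<mu>)) * norm (\<phi> (\<mu> + c n * y))
              \<le> exp (- (a / 2) * y ^ (2 * K)) * B"
            by (intro mult_mono bound) auto
          moreover have "norm (u n y) \<le> exp (real (Suc n) * (f (\<mu> + c n * y) - f \<mu>)) * norm (\<phi> (\<mu> + c n * y))"
            unfolding u_def by (simp split: split_indicator)
          ultimately show ?thesis
            by (simp add: mult.commute)
        next
          case False
          then have "u n y = 0"
            by (simp add: u_def dist_real_def)
          then show ?thesis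
            using B by simp
        qed
      qed
      \<comment> \<open>The origin is excluded: the expansion is a punctured limit, and for
        \<open>k < K\<close> the integrand at \<open>y = 0\<close> stays at
        \<open>\<phi> \<mu>\<close> while \<open>v 0 = 0\<close>.\<close>
      have "(\<lambda>n. u n y) \<longlonglongrightarrow> v y" if y: "y \<noteq> 0" for y
      proof -
        have cy: "(\<lambda>n. c n * y) \<longlonglongrightarrow> 0"
          using tendsto_mult_left_zero[OF c_lim] by simp
        have cy': "filterlim (\<lambda>n. c n * y) (at 0) sequentially"
          using cy c_pos y by (auto simp: filterlim_at less_imp_neq[THEN not_sym])
        have \<phi>: "(\<lambda>n. \<phi> (\<mu> + c n * y)) \<longlonglongrightarrow> \<phi> \<mu>"
          by (rule isCont_tendsto_compose[OF cont]) (use tendsto_add[OF tendsto_const cy] in simp)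
        have ind: "(\<lambda>n. indicator (ball \<mu> \<delta>) (\<mu> + c n * y) :: real) \<longlonglongrightarrow> 1"
        proof (rule tendsto_eventually)
          have "\<forall>\<^sub>F n in sequentially. dist (c n * y) 0 < \<delta>"
            using cy \<delta> by (simp add: tendsto_iff)
          then show "\<forall>\<^sub>F n in sequentially. indicator (ball \<mu> \<delta>) (\<mu> + c n * y) = (1 :: real)"
            by eventually_elim (simp add: dist_real_def)
        qed
        have q: "(\<lambda>n. (f (\<mu> + c n * y) - f \<mu>) / (c n * y) ^ (2 * k)) \<longlonglongrightarrow> - a"
          by (rule filterlim_compose[OF expan cy'])
        \<comment> \<open>The Taylor quotient, which tends to \<open>- a\<close>, times the rescaled
          power computed in \<open>c_pow\<close>.\<close>
        have split: "real (Suc n) * (f (\<mu> + c n * y) - f \<mu>)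
            = (f (\<mu> + c n * y) - f \<mu>) / (c n * y) ^ (2 * k)
              * (real (Suc n) powr (1 - real k / real K) * y ^ (2 * k))" for n
          unfolding c_pow[symmetric] using y c_pos[of n] by simp
        show ?thesis
        proof (cases "k = K")
          case True
          then have "real (Suc n) powr (1 - real k / real K) = 1" for n
            using K by simp
          then have "(\<lambda>n. real (Suc n) * (f (\<mu> + c n * y) - f \<mu>)) \<longlonglongrightarrow> - a * y ^ (2 * K)"
            unfolding split using tendsto_mult_right[OF q, of "y ^ (2 * k)"] True by simp
          from tendsto_scaleR[OF ind tendsto_scaleR[OF tendsto_exp[OF this] \<phi>]] show ?thesis
            using True by (simp add: u_def v_def)
        next
          case False
          then have "0 < 1 - real k / real K"
            using k by simp
          then have "filterlim (\<lambda>n. real (Suc n) powr (1 - real k / real K)) at_top sequentially"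
            by real_asymp
          moreover have "0 < y ^ (2 * k)"
            using y by (simp add: zero_less_power_eq)
          ultimately have "filterlim (\<lambda>n. real (Suc n) powr (1 - real k / real K) * y ^ (2 * k)) at_top sequentially"
            by (intro filterlim_at_top_mult_tendsto_pos[OF tendsto_const])
          then have "filterlim (\<lambda>n. real (Suc n) * (f (\<mu> + c n * y) - f \<mu>)) at_bot sequentially"
            unfolding split using a by (intro filterlim_tendsto_neg_mult_at_bot[OF q]) auto
          then have "(\<lambda>n. exp (real (Suc n) * (f (\<mu> + c n * y) - f \<mu>))) \<longlonglongrightarrow> 0"
            by (rule filterlim_compose[OF exp_at_bot])
          from tendsto_scaleR[OF ind tendsto_scaleR[OF this \<phi>]] show ?thesis
            using False by (simp add: u_def v_def)
        qed
      qed
      then show "AE y in lborel. (\<lambda>n. u n y) \<longlonglongrightarrow> v y"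
        using AE_lborel_singleton[of 0] by (auto elim: eventually_mono)
    qed
    moreover have "(\<integral>y. v y \<partial>lborel) =
        (if k = K then (a powr (- 1 / (2 * real K)) * exp_power_integral K) *\<^sub>R \<phi> \<mu> else 0)"
      unfolding v_def
      using integral_exp_even_power[OF a K] integrable_exp_even_power[OF a K] by simp
    ultimately show ?thesis
      unfolding eq by simp
  qed
  have "0 < d" using d0 by (simp add: d_def)
  then show ?thesis
    using main by blast
qed

text \<open>Quantifying over all smaller radii makes the local statements stable under
  \<open>min\<close>, so finitely many of them share a radius.\<close>

lemma finite_uniform_radius:
  fixes P :: "'a \<Rightarrow> real \<Rightarrow> bool"
  assumes "finite A" "\<And>p. p \<in> A \<Longrightarrow> \<exists>d>0. \<forall>\<delta>. 0 < \<delta> \<and> \<delta> \<le> d \<longrightarrow> P p \<delta>"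
  shows "\<exists>d>0. \<forall>p\<in>A. \<forall>\<delta>. 0 < \<delta> \<and> \<delta> \<le> d \<longrightarrow> P p \<delta>"
  using assms
proof (induction A)
  case empty
  then show ?case by (auto intro: exI[of _ 1])
next
  case (insert p A)
  then obtain d where d: "d > 0" "\<forall>p\<in>A. \<forall>\<delta>. 0 < \<delta> \<and> \<delta> \<le> d \<longrightarrow> P p \<delta>"
    by auto
  obtain d' where "d' > 0" "\<forall>\<delta>. 0 < \<delta> \<and> \<delta> \<le> d' \<longrightarrow> P p \<delta>"
    using insert.prems[of p] by auto
  with d show ?case
    by (intro exI[of _ "min d d'"]) auto
qed

text \<open>Disjoint balls around the points of \<open>A\<close> carry the contributions found in
  \<open>laplace_local\<close>; off the balls the uniform gap makes the integral exponentially
  small, which beats the factor \<open>N powr (1 / (2 * K))\<close>.\<close>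

lemma laplace_global:
  fixes f :: "real \<Rightarrow> real" and \<phi> :: "real \<Rightarrow> complex" and k :: "real \<Rightarrow> nat" and a :: "real \<Rightarrow> real"
  assumes f[measurable]: "f \<in> borel_measurable borel"
    and \<phi>: "continuous_on UNIV \<phi>" and bound: "\<And>x. norm (\<phi> x) \<le> B"
    and int: "integrable lborel (\<lambda>x. exp (f x))"
    and A: "finite A" "\<And>p. p \<in> A \<Longrightarrow> f p = M" and le: "\<And>x. f x \<le> M"
    and gap: "\<And>S. open S \<Longrightarrow> A \<subseteq> S \<Longrightarrow> \<exists>\<epsilon>>0. \<forall>x. x \<notin> S \<longrightarrow> f x \<le> M - \<epsilon>"
    and expan: "\<And>p. p \<in> A \<Longrightarrow> ((\<lambda>z. (f (p + z) - f p) / z ^ (2 * k p)) \<longlongrightarrow> - a p) (at 0)"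
    and a: "\<And>p. p \<in> A \<Longrightarrow> 0 < a p"
    and k: "\<And>p. p \<in> A \<Longrightarrow> 1 \<le> k p" "\<And>p. p \<in> A \<Longrightarrow> k p \<le> K"
  shows "(\<lambda>n. real (Suc n) powr (1 / (2 * real K)) *\<^sub>R
       (\<integral>x. exp (real (Suc n) * (f x - M)) *\<^sub>R \<phi> x \<partial>lborel))
    \<longlonglongrightarrow> (\<Sum>p\<in>{p \<in> A. k p = K}. (a p powr (- 1 / (2 * real K)) * exp_power_integral K) *\<^sub>R \<phi> p)"
proof -
  have [measurable]: "\<phi> \<in> borel_measurable borel"
    using \<phi> by (rule borel_measurable_continuous_onI)
  define L where "L p = (if k p = K then (a p powr (- 1 / (2 * real K)) * exp_power_integral K) *\<^sub>R \<phi> p else 0)"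
    for p
  define F where "F n x = exp (real (Suc n) * (f x - M)) *\<^sub>R \<phi> x" for n x
  define P where "P p \<delta> \<longleftrightarrow> (\<lambda>n. real (Suc n) powr (1 / (2 * real K)) *\<^sub>R
       (\<integral>x. indicator (ball p \<delta>) x *\<^sub>R F n x \<partial>lborel)) \<longlonglongrightarrow> L p" for p \<delta>
  have B: "0 \<le> B"
    using bound[of 0] norm_ge_zero order_trans by blast
  have "\<exists>d>0. \<forall>\<delta>. 0 < \<delta> \<and> \<delta> \<le> d \<longrightarrow> P p \<delta>" if "p \<in> A" for p
    unfolding P_def F_def L_def
    using laplace_local[of f \<phi> p B "k p" "a p" K] \<phi> bound expan[OF that] a[OF that] k[OF that] A(2)[OF that]
    by (simp add: continuous_on_eq_continuous_at)
  then obtain d1 where d1: "d1 > 0" "\<And>p \<delta>. p \<in> A \<Longrightarrow> 0 < \<delta> \<Longrightarrow> \<delta> \<le> d1 \<Longrightarrow> P p \<delta>"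
    using finite_uniform_radius[OF A(1), of P] by blast
  have "\<exists>d>0. \<forall>\<delta>. 0 < \<delta> \<and> \<delta> \<le> d \<longrightarrow> (\<forall>x\<in>A. x \<noteq> p \<longrightarrow> \<delta> \<le> dist p x)" for p
    using finite_set_avoid[OF A(1), of p] by force
  then obtain d2 where d2: "d2 > 0" "\<And>p \<delta> x. p \<in> A \<Longrightarrow> 0 < \<delta> \<Longrightarrow> \<delta> \<le> d2 \<Longrightarrow> x \<in> A \<Longrightarrow> x \<noteq> p \<Longrightarrow> \<delta> \<le> dist p x"
    using finite_uniform_radius[OF A(1), of "\<lambda>p \<delta>. \<forall>x\<in>A. x \<noteq> p \<longrightarrow> \<delta> \<le> dist p x"] by blast
  \<comment> \<open>\<open>d2\<close> only keeps distinct points of \<open>A\<close> apart; halving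
    it makes the balls themselves disjoint.\<close>
  define \<delta> where "\<delta> = min d1 (d2 / 2)"
  have \<delta>: "0 < \<delta>" using d1 d2 by (simp add: \<delta>_def)
  have lim: "P p \<delta>" if "p \<in> A" for p
    using d1(2)[OF that \<delta>] by (simp add: \<delta>_def)
  have disj: "disjoint_family_on (\<lambda>p. ball p \<delta>) A"
    unfolding disjoint_family_on_def
  proof (intro ballI impI)
    fix p q assume "p \<in> A" "q \<in> A" "p \<noteq> q"
    then have "2 * \<delta> \<le> dist p q"
      using d2(2)[of p "d2" q] d2(1) by (auto simp: \<delta>_def)
    then show "ball p \<delta> \<inter> ball q \<delta> = {}"
      by (intro disjoint_ballI) simp
  qed
  define U where "U = (\<Union>p\<in>A. ball p \<delta>)"
  have U: "open U" "A \<subseteq> U" "U \<in> sets borel"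
    using \<delta> by (auto simp: U_def intro!: borel_open)
  note [measurable] = U(3)
  obtain \<epsilon> where \<epsilon>: "\<epsilon> > 0" "\<And>x. x \<notin> U \<Longrightarrow> f x \<le> M - \<epsilon>"
    using gap[OF U(1,2)] by blast
  have indU: "indicator U x = (\<Sum>p\<in>A. indicator (ball p \<delta>) x :: real)" for x
    unfolding U_def by (rule indicator_UN_disjoint[OF A(1) disj])
  \<comment> \<open>As \<open>f x - M\<close> is nonpositive, a higher power of
    \<open>exp (f x - M)\<close> is smaller than the first; integrability of \<open>exp f\<close>
    thus suffices for all \<open>n\<close>.\<close>
  have bnd1: "exp (real (Suc n) * (f x - M)) \<le> exp (f x - M)" for n x
    using mult_nonneg_nonneg[of "real n" "M - f x"] le[of x] by (simp add: of_nat_Suc algebra_simps)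
  have int': "integrable lborel (\<lambda>x. exp (f x - M))"
    using int by (simp add: exp_diff)
  have intF: "integrable lborel (F n)" for n
  proof (rule Bochner_Integration.integrable_bound)
    show "integrable lborel (\<lambda>x. B * exp (f x - M))" using int' by simp
    show "F n \<in> borel_measurable lborel" unfolding F_def by measurable
    show "AE x in lborel. norm (F n x) \<le> norm (B * exp (f x - M))"
      unfolding F_def using mult_mono[OF bnd1 bound] B by (simp add: mult.commute)
  qed
  have intF': "integrable lborel (\<lambda>x. indicator S x *\<^sub>R F n x)" if "S \<in> sets borel" for n S
    using integrable_mult_indicator[OF _ intF] that by simp
  have decomp: "(\<integral>x. F n x \<partial>lborel) = (\<Sum>p\<in>A. \<integral>x. indicator (ball p \<delta>) x *\<^sub>R F n x \<partial>lborel)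
      + (\<integral>x. indicator (- U) x *\<^sub>R F n x \<partial>lborel)" for n
  proof -
    have "F n x = (\<Sum>p\<in>A. indicator (ball p \<delta>) x *\<^sub>R F n x) + indicator (- U) x *\<^sub>R F n x" for x
      by (simp add: indicator_compl indU algebra_simps flip: scaleR_left.sum)
    then have "(\<integral>x. F n x \<partial>lborel) = (\<integral>x. (\<Sum>p\<in>A. indicator (ball p \<delta>) x *\<^sub>R F n x) + indicator (- U) x *\<^sub>R F n x \<partial>lborel)"
      by presburger
    also have "\<dots> = (\<integral>x. (\<Sum>p\<in>A. indicator (ball p \<delta>) x *\<^sub>R F n x) \<partial>lborel) + (\<integral>x. indicator (- U) x *\<^sub>R F n x \<partial>lborel)"
      by (intro Bochner_Integration.integral_add Bochner_Integration.integrable_sum intF') auto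
    finally show ?thesis
      using intF' by (simp add: Bochner_Integration.integral_sum)
  qed
  have "(\<lambda>n. real (Suc n) powr (1 / (2 * real K)) *\<^sub>R (\<integral>x. indicator (- U) x *\<^sub>R F n x \<partial>lborel)) \<longlonglongrightarrow> 0"
  proof (rule Lim_null_comparison)
    define C where "C = B * (\<integral>x. exp (f x - M) \<partial>lborel)"
    show "\<forall>\<^sub>F n in sequentially. norm (real (Suc n) powr (1 / (2 * real K)) *\<^sub>R (\<integral>x. indicator (- U) x *\<^sub>R F n x \<partial>lborel))
      \<le> (real (Suc n) powr (1 / (2 * real K)) * exp (- \<epsilon> * real n)) * C"
    proof (rule always_eventually, rule allI)
      fix n
      have "norm (indicator (- U) x *\<^sub>R F n x) \<le> exp (- \<epsilon> * real n) * (B * exp (f x - M))" for x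
      proof (cases "x \<in> U")
        case True
        then show ?thesis using B by simp
      next
        case False
        \<comment> \<open>Of the \<open>n + 1\<close> factors, \<open>n\<close> are spent on the
          decay \<open>exp (- \<epsilon> * n)\<close> and the last is kept for
          integrability.\<close>
        have "real n * (f x - M) \<le> real n * (- \<epsilon>)"
          using \<epsilon>(2)[OF False] by (intro mult_left_mono) auto
        then have "real (Suc n) * (f x - M) \<le> - \<epsilon> * real n + (f x - M)"
          by (simp add: of_nat_Suc algebra_simps)
        then have "exp (real (Suc n) * (f x - M)) \<le> exp (- \<epsilon> * real n) * exp (f x - M)"
          by (simp flip: exp_add)
        from mult_mono[OF this bound[of x]] show ?thesis
          using False B by (simp add: F_def mult_ac)
      qed
      then have "norm (\<integral>x. indicator (- U) x *\<^sub>R F n x \<partial>lborel) \<le> (\<integral>x. exp (- \<epsilon> * real n) * (B * exp (f x - M)) \<partial>lborel)"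
        using int' by (intro order_trans[OF integral_norm_bound] integral_mono integrable_norm intF') auto
      also have "\<dots> = exp (- \<epsilon> * real n) * C"
        by (simp add: C_def)
      finally show "norm (real (Suc n) powr (1 / (2 * real K)) *\<^sub>R (\<integral>x. indicator (- U) x *\<^sub>R F n x \<partial>lborel))
        \<le> (real (Suc n) powr (1 / (2 * real K)) * exp (- \<epsilon> * real n)) * C"
        by (simp add: mult.assoc mult_left_mono)
    qed
    have "(\<lambda>n. real (Suc n) powr r * exp (- \<epsilon> * real n)) \<longlonglongrightarrow> 0" for r
      using \<epsilon>(1) by real_asymp
    then show "(\<lambda>n. (real (Suc n) powr (1 / (2 * real K)) * exp (- \<epsilon> * real n)) * C) \<longlonglongrightarrow> 0"
      by (rule tendsto_mult_left_zero)
  qed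
  moreover have "(\<lambda>n. \<Sum>p\<in>A. real (Suc n) powr (1 / (2 * real K)) *\<^sub>R
      (\<integral>x. indicator (ball p \<delta>) x *\<^sub>R F n x \<partial>lborel)) \<longlonglongrightarrow> (\<Sum>p\<in>A. L p)"
    using lim by (intro tendsto_sum) (simp add: P_def)
  ultimately have "(\<lambda>n. (\<Sum>p\<in>A. real (Suc n) powr (1 / (2 * real K)) *\<^sub>R
      (\<integral>x. indicator (ball p \<delta>) x *\<^sub>R F n x \<partial>lborel)) +
      real (Suc n) powr (1 / (2 * real K)) *\<^sub>R (\<integral>x. indicator (- U) x *\<^sub>R F n x \<partial>lborel)) \<longlonglongrightarrow> (\<Sum>p\<in>A. L p) + 0"
    by (intro tendsto_add)
  then have "(\<lambda>n. real (Suc n) powr (1 / (2 * real K)) *\<^sub>R (\<integral>x. F n x \<partial>lborel)) \<longlonglongrightarrow> (\<Sum>p\<in>A. L p)"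
    by (simp add: decomp scaleR_right.sum scaleR_add_right)
  moreover have "(\<Sum>p\<in>A. L p) = (\<Sum>p\<in>{p \<in> A. k p = K}. (a p powr (- 1 / (2 * real K)) * exp_power_integral K) *\<^sub>R \<phi> p)"
    unfolding L_def using A(1) by (simp add: sum.If_cases Int_def)
  ultimately show ?thesis
    by (simp add: F_def)
qed

subsection \<open>The Hubbard--Stratonovich transformation\<close>

lemma gaussian_integrable:
  fixes b c :: real
  assumes "0 < c"
  shows "integrable lborel (\<lambda>x. exp (- c * x\<^sup>2 / 2 + b * x))"
proof -
  have "exp (- c * x\<^sup>2 / 2 + b * x)
      = (sqrt (2 * pi * (1 / sqrt c)\<^sup>2) * exp (b\<^sup>2 / (2 * c))) * normal_density (b / c) (1 / sqrt c) x" for x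
  proof -
    have eq: "- c * x\<^sup>2 / 2 + b * x = b\<^sup>2 / (2 * c) + - (x - b / c)\<^sup>2 / (2 * (1 / sqrt c)\<^sup>2)"
      using assms by (simp add: field_simps power2_eq_square)
    show ?thesis
      unfolding eq exp_add normal_density_def using assms by simp
  qed
  then show ?thesis
    using assms by simp
qed

text \<open>The substitution \<open>x = b / c + y / sqrt c\<close> reduces this to the standard
  normal characteristic function. The first factor on the right is free of \<open>b\<close>: when
  \<open>b\<close> depends on the spins, it can be pulled out of the integral over them.\<close>

lemma gaussian_fourier:
  fixes b c t :: real
  assumes c: "0 < c"
  shows "(\<integral>x. iexp (t * x) * of_real (exp (- c * x\<^sup>2 / 2 + b * x)) \<partial>lborel)
    = of_real (sqrt (2 * pi / c) * exp (- t\<^sup>2 / (2 * c))) * (iexp (t * (b / c)) * of_real (exp (b\<^sup>2 / (2 * c))))"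
proof -
  define s where "s = 1 / sqrt c"
  have s: "s \<noteq> 0" "0 < s" "c * s\<^sup>2 = 1"
    using c by (auto simp: s_def power_divide)
  have std: "(\<integral>y. iexp (u * y) * of_real (exp (- y\<^sup>2 / 2)) \<partial>lborel) = of_real (sqrt (2 * pi) * exp (- u\<^sup>2 / 2))" for u
  proof -
    have "(\<integral>y. iexp (u * y) * of_real (exp (- y\<^sup>2 / 2)) \<partial>lborel)
      = of_real (sqrt (2 * pi)) * (\<integral>y. std_normal_density y *\<^sub>R iexp (u * y) \<partial>lborel)"
      unfolding integral_mult_right_zero[symmetric]
      by (intro Bochner_Integration.integral_cong) (auto simp: std_normal_density_def scaleR_conv_of_real)
    also have "(\<integral>y. std_normal_density y *\<^sub>R iexp (u * y) \<partial>lborel) = char std_normal_distribution u"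
      unfolding char_def by (subst integral_density) (auto simp: normal_density_nonneg)
    finally show ?thesis
      by (simp add: char_std_normal_distribution)
  qed
  have exponent: "- c * (b / c + s * y)\<^sup>2 / 2 + b * (b / c + s * y) = b\<^sup>2 / (2 * c) + (- y\<^sup>2 / 2)" for y
  proof -
    have "(s * y)\<^sup>2 * c = y\<^sup>2"
      using s(3) by (simp add: power_mult_distrib mult.commute mult.left_commute)
    moreover have "- c * (b / c + z)\<^sup>2 / 2 + b * (b / c + z) = b\<^sup>2 / (2 * c) + (- (z\<^sup>2 * c) / 2)" for z
      using c by (simp add: field_simps power2_eq_square)
    ultimately show ?thesis
      by metis
  qed
  have factor: "iexp (t * (b / c + s * y)) * of_real (exp (b\<^sup>2 / (2 * c) + (- y\<^sup>2 / 2)))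
      = (iexp (t * (b / c)) * of_real (exp (b\<^sup>2 / (2 * c)))) * (iexp ((t * s) * y) * of_real (exp (- y\<^sup>2 / 2)))" for y
  proof -
    have "iexp (t * (b / c + s * y)) = iexp (t * (b / c)) * iexp ((t * s) * y)"
      unfolding exp_add[symmetric] by (rule arg_cong[where f = exp]) (simp add: algebra_simps)
    then show ?thesis
      unfolding exp_add of_real_mult by (simp only: mult_ac)
  qed
  have "(\<integral>x. iexp (t * x) * of_real (exp (- c * x\<^sup>2 / 2 + b * x)) \<partial>lborel)
     = s *\<^sub>R (\<integral>y. iexp (t * (b / c + s * y)) * of_real (exp (- c * (b / c + s * y)\<^sup>2 / 2 + b * (b / c + s * y))) \<partial>lborel)"
    using s(2) by (subst lborel_integral_real_affine[OF s(1), where t = "b / c"]) simp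
  also have "\<dots> = s *\<^sub>R (\<integral>y. (iexp (t * (b / c)) * of_real (exp (b\<^sup>2 / (2 * c)))) *
      (iexp ((t * s) * y) * of_real (exp (- y\<^sup>2 / 2))) \<partial>lborel)"
    unfolding exponent factor ..
  also have "\<dots> = s *\<^sub>R ((iexp (t * (b / c)) * of_real (exp (b\<^sup>2 / (2 * c)))) * of_real (sqrt (2 * pi) * exp (- (t * s)\<^sup>2 / 2)))"
    by (simp only: integral_mult_right_zero std)
  also have "\<dots> = of_real ((s * sqrt (2 * pi)) * exp (- (t * s)\<^sup>2 / 2)) * (iexp (t * (b / c)) * of_real (exp (b\<^sup>2 / (2 * c))))"
    by (simp only: scaleR_conv_of_real of_real_mult mult_ac)
  also have "s * sqrt (2 * pi) = sqrt (2 * pi / c)"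
    by (simp add: s_def real_sqrt_divide)
  also have "- (t * s)\<^sup>2 / 2 = - t\<^sup>2 / (2 * c)"
    using c by (simp add: s_def power_mult_distrib power_divide)
  finally show ?thesis .
qed

lemma gaussian_integral:
  fixes b c :: real
  assumes c: "0 < c"
  shows "(\<integral>x. exp (- c * x\<^sup>2 / 2 + b * x) \<partial>lborel) = sqrt (2 * pi / c) * exp (b\<^sup>2 / (2 * c))"
proof -
  have "complex_of_real (\<integral>x. exp (- c * x\<^sup>2 / 2 + b * x) \<partial>lborel) = of_real (sqrt (2 * pi / c) * exp (b\<^sup>2 / (2 * c)))"
    using gaussian_fourier[OF c, of 0 b] by (simp flip: of_real_exp)
  then show ?thesis
    by (simp only: of_real_eq_iff)
qed

section \<open>Curie-Weiss measures at finite size\<close>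

context cw_model
begin

abbreviation spins :: "nat \<Rightarrow> (nat \<Rightarrow> real) measure" where
  "spins N \<equiv> PiM {..<N} (\<lambda>_. \<rho>)"

text \<open>The double sum is a perfect square. With \<open>S\<close> the spin sum, the quadratic
  part is written as \<open>b\<^sup>2 / (2 * c)\<close> for \<open>b = J * S\<close> and
  \<open>c = N * J\<close>, the exponent that \<open>gaussian_integral\<close> produces.\<close>

lemma hamil_eq:
  assumes "0 < N"
  shows "- hamil J h N \<sigma> = (J * (\<Sum>i<N. \<sigma> i))\<^sup>2 / (2 * (real N * J)) + h * (\<Sum>i<N. \<sigma> i)"
  using assms J_pos by (simp add: hamil_def power2_eq_square flip: sum_product)

lemma measurable_spin_sum [measurable]: "(\<lambda>\<sigma>. \<Sum>i<N. \<sigma> i) \<in> borel_measurable (spins N)"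
  by measurable

lemma measurable_hamil [measurable]: "hamil J h N \<in> borel_measurable (spins N)"
  unfolding hamil_def[abs_def] by measurable

lemma product_sigma_finite_rho: "product_sigma_finite (\<lambda>_::nat. \<rho>)"
  by (simp add: product_sigma_finite_def sigma_finite_measure_axioms)

text \<open>Cauchy-Schwarz bounds the squared spin sum by \<open>N\<close> times the sum of squares,
  hence the mean-field weight by a product of one-spin factors, each integrable by
  \<open>integrable_gauss\<close> with \<open>a = J\<close>.\<close>

lemma integrable_boltzmann:
  assumes N: "0 < N"
  shows "integrable (spins N) (\<lambda>\<sigma>. exp (- hamil J h N \<sigma>))"
proof (rule Bochner_Integration.integrable_bound)
  interpret product_sigma_finite "\<lambda>_::nat. \<rho>" by (rule product_sigma_finite_rho)
  show "integrable (spins N) (\<lambda>\<sigma>. \<Prod>i<N. exp (J * (\<sigma> i)\<^sup>2 / 2 + h * \<sigma> i))"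
    by (intro product_integrable_prod integrable_gauss J_pos) simp
  have "- hamil J h N \<sigma> \<le> (\<Sum>i<N. J * (\<sigma> i)\<^sup>2 / 2 + h * \<sigma> i)" for \<sigma>
  proof -
    have "(\<Sum>i<N. \<sigma> i)\<^sup>2 \<le> real N * (\<Sum>i<N. (\<sigma> i)\<^sup>2)"
      using Cauchy_Schwarz_ineq_sum[of "\<lambda>_. 1" \<sigma> "{..<N}"] by simp
    then have "J / (2 * real N) * (\<Sum>i<N. \<sigma> i)\<^sup>2 \<le> J / (2 * real N) * (real N * (\<Sum>i<N. (\<sigma> i)\<^sup>2))"
      using J_pos by (intro mult_left_mono) auto
    moreover have "- hamil J h N \<sigma> = J / (2 * real N) * (\<Sum>i<N. \<sigma> i)\<^sup>2 + h * (\<Sum>i<N. \<sigma> i)"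
      unfolding hamil_eq[OF N] using J_pos N by (simp add: field_simps power2_eq_square)
    moreover have "J / (2 * real N) * (real N * (\<Sum>i<N. (\<sigma> i)\<^sup>2)) = (\<Sum>i<N. J * (\<sigma> i)\<^sup>2 / 2)"
      using N by (simp add: sum_distrib_left sum_divide_distrib)
    ultimately show ?thesis
      by (simp add: sum.distrib sum_distrib_left)
  qed
  then show "AE \<sigma> in spins N. norm (exp (- hamil J h N \<sigma>)) \<le> norm (\<Prod>i<N. exp (J * (\<sigma> i)\<^sup>2 / 2 + h * \<sigma> i))"
    by (simp flip: exp_sum)
qed measurable

lemma partfun_pos:
  assumes "0 < N"
  shows "0 < partfun \<rho> J h N"
proof -
  interpret P: prob_space "spins N"
    by (intro prob_space_PiM prob_space_axioms)
  have "partfun \<rho> J h N \<noteq> 0"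
    using integral_nonneg_eq_0_iff_AE[OF integrable_boltzmann[OF assms]] by (simp add: partfun_def)
  moreover have "0 \<le> partfun \<rho> J h N"
    unfolding partfun_def by simp
  ultimately show ?thesis
    by simp
qed

text \<open>Hubbard--Stratonovich: \<open>exp (J S\<^sup>2 / (2 N))\<close> is a Gaussian integral of \<open>exp (J S x)\<close>, which
  makes the spins independent given \<open>x\<close>.  Equivalently, \<open>exp (N f)\<close> is, up to a constant, the
  density of the magnetization plus an independent centred Gaussian of variance \<open>1 / (N J)\<close>.\<close>

lemma hubbard_stratonovich:
  assumes N: "0 < N"
  shows "integrable lborel (\<lambda>x. exp (real N * f x))"
    and "(\<integral>x. iexp (t * x) * of_real (exp (real N * f x)) \<partial>lborel)
      = of_real (sqrt (2 * pi / (real N * J)) * exp (- t\<^sup>2 / (2 * (real N * J))))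
        * (\<integral>\<sigma>. iexp (t * magn N \<sigma>) * of_real (exp (- hamil J h N \<sigma>)) \<partial>spins N)"
proof -
  interpret P: prob_space "spins N"
    by (intro prob_space_PiM prob_space_axioms)
  interpret PP: product_sigma_finite "\<lambda>_::nat. \<rho>" by (rule product_sigma_finite_rho)
  interpret Q: pair_sigma_finite "spins N" lborel ..
  define c where "c = real N * J"
  have c: "0 < c" using N J_pos by (simp add: c_def)
  define S where "S \<sigma> = (\<Sum>i<N. \<sigma> i)" for \<sigma> :: "nat \<Rightarrow> real"
  have [measurable]: "S \<in> borel_measurable (spins N)"
    unfolding S_def by measurable
  \<comment> \<open>Joint weight of the spins and an auxiliary field \<open>x\<close>: integrating
    out \<open>x\<close> returns the Boltzmann weight up to a constant, integrating out the spins
    gives \<open>exp (N * f x)\<close>.\<close>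
  define G where "G \<sigma> x = exp (h * S \<sigma>) * exp (- c * x\<^sup>2 / 2 + (J * S \<sigma>) * x)" for \<sigma> x
  have G_meas [measurable]: "case_prod G \<in> borel_measurable (spins N \<Otimes>\<^sub>M lborel)"
    unfolding G_def by measurable
  have hamil_S: "exp (- hamil J h N \<sigma>) = exp (h * S \<sigma>) * exp ((J * S \<sigma>)\<^sup>2 / (2 * c))" for \<sigma>
    unfolding hamil_eq[OF N] S_def c_def by (simp add: exp_add)
  have G_int: "integrable (spins N \<Otimes>\<^sub>M lborel) (case_prod G)"
  proof (rule Q.Fubini_integrable)
    have "(\<integral>x. norm (case_prod G (\<sigma>, x)) \<partial>lborel) = sqrt (2 * pi / c) * exp (- hamil J h N \<sigma>)" for \<sigma>
      unfolding hamil_S by (simp add: G_def gaussian_integral[OF c, of "J * S \<sigma>", simplified])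
    then show "integrable (spins N) (\<lambda>\<sigma>. \<integral>x. norm (case_prod G (\<sigma>, x)) \<partial>lborel)"
      using integrable_boltzmann[OF N] by simp
    show "AE \<sigma> in spins N. integrable lborel (\<lambda>x. case_prod G (\<sigma>, x))"
      using gaussian_integrable[OF c] by (simp add: G_def)
  qed (rule G_meas)
  have G_prod: "G \<sigma> x = exp (- c * x\<^sup>2 / 2) * (\<Prod>i<N. exp (\<sigma> i * (J * x + h)))" for \<sigma> x
  proof -
    have "(\<Prod>i<N. exp (\<sigma> i * (J * x + h))) = exp (S \<sigma> * (J * x + h))"
      by (simp add: S_def sum_distrib_right flip: exp_sum)
    then show ?thesis
      by (simp add: G_def algebra_simps flip: exp_add)
  qed
  have G_spins: "(\<integral>\<sigma>. G \<sigma> x \<partial>spins N) = exp (real N * f x)" for x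
  proof -
    have "(\<integral>\<sigma>. G \<sigma> x \<partial>spins N) = exp (- c * x\<^sup>2 / 2) * (\<integral>s. exp (s * (J * x + h)) \<partial>\<rho>) ^ N"
    proof -
      have "(\<integral>\<sigma>. (\<Prod>i<N. exp (\<sigma> i * (J * x + h))) \<partial>spins N) = (\<Prod>i<N. \<integral>s. exp (s * (J * x + h)) \<partial>\<rho>)"
        by (rule PP.product_integral_prod) (auto intro: integrable_exp_linear)
      then show ?thesis
        unfolding G_prod by simp
    qed
    also have "exp (- c * x\<^sup>2 / 2) = exp (- J / 2 * x\<^sup>2) ^ N"
      by (simp add: c_def algebra_simps flip: exp_of_nat_mult)
    finally show ?thesis
      by (simp add: exp_of_nat_mult exp_fCW power_mult_distrib)
  qed
  show "integrable lborel (\<lambda>x. exp (real N * f x))"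
    using Q.integrable_snd[OF G_int] by (simp add: G_spins)
  have int: "integrable (spins N \<Otimes>\<^sub>M lborel) (\<lambda>(\<sigma>, x). iexp (t * x) * of_real (G \<sigma> x))"
    by (rule Bochner_Integration.integrable_bound[OF G_int]) (auto simp: norm_mult)
  have inner: "(\<integral>x. iexp (t * x) * of_real (G \<sigma> x) \<partial>lborel)
      = of_real (sqrt (2 * pi / c) * exp (- t\<^sup>2 / (2 * c))) * (iexp (t * magn N \<sigma>) * of_real (exp (- hamil J h N \<sigma>)))" for \<sigma>
  proof -
    have "(\<integral>x. iexp (t * x) * of_real (G \<sigma> x) \<partial>lborel)
        = (\<integral>x. of_real (exp (h * S \<sigma>)) * (iexp (t * x) * of_real (exp (- c * x\<^sup>2 / 2 + (J * S \<sigma>) * x))) \<partial>lborel)"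
      by (intro Bochner_Integration.integral_cong) (simp_all only: G_def of_real_mult mult_ac)
    also have "\<dots> = of_real (exp (h * S \<sigma>)) * (of_real (sqrt (2 * pi / c) * exp (- t\<^sup>2 / (2 * c)))
        * (iexp (t * (J * S \<sigma> / c)) * of_real (exp ((J * S \<sigma>)\<^sup>2 / (2 * c)))))"
      by (simp only: integral_mult_right_zero gaussian_fourier[OF c])
    \<comment> \<open>The mean of the Gaussian in \<open>x\<close> for given spins is the
      magnetization.\<close>
    also have "J * S \<sigma> / c = magn N \<sigma>"
      using J_pos by (simp add: c_def magn_def S_def)
    finally show ?thesis
      unfolding hamil_S by (simp only: of_real_mult mult_ac)
  qed
  have "(\<integral>x. iexp (t * x) * of_real (exp (real N * f x)) \<partial>lborel)
      = (\<integral>x. (\<integral>\<sigma>. iexp (t * x) * of_real (G \<sigma> x) \<partial>spins N) \<partial>lborel)"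
    by (simp add: G_spins[symmetric])
  also have "\<dots> = (\<integral>\<sigma>. (\<integral>x. iexp (t * x) * of_real (G \<sigma> x) \<partial>lborel) \<partial>spins N)"
    by (rule Q.Fubini_integral[OF int])
  also have "\<dots> = (\<integral>\<sigma>. of_real (sqrt (2 * pi / c) * exp (- t\<^sup>2 / (2 * c)))
      * (iexp (t * magn N \<sigma>) * of_real (exp (- hamil J h N \<sigma>))) \<partial>spins N)"
    by (simp only: inner)
  finally show "(\<integral>x. iexp (t * x) * of_real (exp (real N * f x)) \<partial>lborel)
      = of_real (sqrt (2 * pi / (real N * J)) * exp (- t\<^sup>2 / (2 * (real N * J))))
        * (\<integral>\<sigma>. iexp (t * magn N \<sigma>) * of_real (exp (- hamil J h N \<sigma>)) \<partial>spins N)"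
    by (simp only: integral_mult_right_zero c_def)
qed

section \<open>Law and characteristic function of the magnetization\<close>

lemma measurable_magn [measurable]: "magn N \<in> borel_measurable (spins N)"
  unfolding magn_def[abs_def] by measurable

lemma real_distribution_magn_law:
  assumes N: "0 < N"
  shows "real_distribution (magn_law \<rho> J h N)"
proof -
  have "emeasure (gibbs \<rho> J h N) (space (gibbs \<rho> J h N)) = 1"
  proof -
    have "(\<integral>\<^sup>+\<sigma>. ennreal (exp (- hamil J h N \<sigma>) / partfun \<rho> J h N) \<partial>spins N)
        = ennreal (\<integral>\<sigma>. exp (- hamil J h N \<sigma>) / partfun \<rho> J h N \<partial>spins N)"
      using integrable_boltzmann[OF N] partfun_pos[OF N] by (intro nn_integral_eq_integral) auto
    also have "\<dots> = 1"
      using partfun_pos[OF N] by (simp add: partfun_def)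
    finally show ?thesis
      by (simp add: gibbs_def emeasure_density cong: nn_integral_cong_simp)
  qed
  then interpret G: prob_space "gibbs \<rho> J h N"
    by (rule prob_spaceI)
  have "prob_space (magn_law \<rho> J h N)"
    unfolding magn_law_def by (rule G.prob_space_distr) (simp add: gibbs_def)
  then show ?thesis
    by (simp add: real_distribution_def real_distribution_axioms_def magn_law_def)
qed

text \<open>The partition function is the spin integral at \<open>t = 0\<close>, so dividing
  \<open>hubbard_stratonovich\<close> by its instance at 0 cancels the constants; the Gaussian
  factor moves across as its exact inverse.\<close>

lemma char_magn_law:
  assumes N: "0 < N"
  shows "char (magn_law \<rho> J h N) t = of_real (exp (t\<^sup>2 / (2 * (real N * J)))) *
    ((\<integral>x. iexp (t * x) * of_real (exp (real N * f x)) \<partial>lborel) / (\<integral>x. of_real (exp (real N * f x)) \<partial>lborel))"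
proof -
  define c where "c = real N * J"
  define I where "I t = (\<integral>\<sigma>. iexp (t * magn N \<sigma>) * of_real (exp (- hamil J h N \<sigma>)) \<partial>spins N)" for t
  have c: "0 < c" using N J_pos by (simp add: c_def)
  have "char (magn_law \<rho> J h N) t
      = (\<integral>\<sigma>. (exp (- hamil J h N \<sigma>) / partfun \<rho> J h N) *\<^sub>R iexp (t * magn N \<sigma>) \<partial>spins N)"
    unfolding char_def magn_law_def gibbs_def using partfun_pos[OF N]
    by (subst integral_distr) (auto simp: integral_density)
  also have "\<dots> = (\<integral>\<sigma>. (iexp (t * magn N \<sigma>) * of_real (exp (- hamil J h N \<sigma>))) / of_real (partfun \<rho> J h N) \<partial>spins N)"
    by (simp add: scaleR_conv_of_real mult.commute)
  also have "\<dots> = I t / of_real (partfun \<rho> J h N)"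
    by (simp add: I_def)
  also have "of_real (partfun \<rho> J h N) = I 0"
    by (simp add: I_def partfun_def flip: of_real_exp)
  finally have char: "char (magn_law \<rho> J h N) t = I t / I 0" .
  have F: "(\<integral>x. iexp (t * x) * of_real (exp (real N * f x)) \<partial>lborel)
      = of_real (sqrt (2 * pi / c) * exp (- t\<^sup>2 / (2 * c))) * I t" for t
    unfolding c_def I_def by (rule hubbard_stratonovich(2)[OF N])
  have F0: "(\<integral>x. complex_of_real (exp (real N * f x)) \<partial>lborel) = of_real (sqrt (2 * pi / c)) * I 0"
    using F[of 0] by simp
  have inv: "complex_of_real (exp (t\<^sup>2 / (2 * c))) * of_real (exp (- t\<^sup>2 / (2 * c))) = 1"
    by (simp only: of_real_mult[symmetric] exp_add[symmetric]) simp
  have nz: "complex_of_real (sqrt (2 * pi / c)) \<noteq> 0"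
    using c by simp
  have quot: "u / v = E * ((q * e * u) / (q * v))" if "E * e = 1" "q \<noteq> 0" for E e q u v :: complex
  proof -
    have "(q * e * u) / (q * v) = (e * u) / v"
      using that by (simp add: mult.assoc)
    then have "E * ((q * e * u) / (q * v)) = (E * e) * u / v"
      by (simp add: mult.assoc)
    then show ?thesis
      using that by simp
  qed
  show ?thesis
    unfolding char F F0 c_def[symmetric] of_real_mult[of "sqrt (2 * pi / c)"] by (rule quot[OF inv nz])
qed

subsection \<open>Convergence of the laws\<close>

lemma max_type_points_eq: "max_type_points f = {p \<in> global_max_points f. point_type f p = max_type f}"
  by (simp add: max_type_points_def)

lemma max_type_ge: "p \<in> global_max_points f \<Longrightarrow> point_type f p \<le> max_type f"
  unfolding max_type_def using finite_max_points by simp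

lemma max_type_points: "finite (max_type_points f)" "max_type_points f \<noteq> {}"
proof -
  show "finite (max_type_points f)"
    using finite_max_points by (simp add: max_type_points_def)
  have "max_type f \<in> point_type f ` global_max_points f"
    unfolding max_type_def
    using finite_max_points global_max_points_coercive(1)[OF continuous_fCW fCW_at_bot] by simp
  then show "max_type_points f \<noteq> {}"
    by (auto simp: max_type_points_def)
qed

lemma max_type_ge_1: "1 \<le> max_type f"
  using max_type_points(2) fCW_type(3) by (force simp: max_type_points_def)

lemma cw_weight_pos: "p \<in> max_type_points f \<Longrightarrow> 0 < cw_weight f p"
  using fCW_type(4)[of p] by (simp add: cw_weight_def max_type_points_def)

lemma sum_cw_weight_pos: "0 < (\<Sum>p\<in>max_type_points f. cw_weight f p)"
  using max_type_points cw_weight_pos by (intro sum_pos)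

text \<open>\<open>C\<close> and \<open>s\<close> are fixed before \<open>\<phi>\<close>, so they
  cancel when two test functions are compared.\<close>

lemma laplace_fCW:
  obtains C :: real and s :: "nat \<Rightarrow> real" where "C \<noteq> 0"
    "\<And>\<phi> B. continuous_on UNIV \<phi> \<Longrightarrow> (\<And>x. norm (\<phi> x) \<le> B) \<Longrightarrow>
      (\<lambda>n. of_real (s n) * (\<integral>x. \<phi> x * of_real (exp (real (Suc n) * f x)) \<partial>lborel))
      \<longlonglongrightarrow> of_real C * (\<Sum>p\<in>max_type_points f. of_real (cw_weight f p) * \<phi> p :: complex)"
    "\<And>n. s n \<noteq> 0"
proof -
  define K where "K = max_type f"
  obtain m where m: "m \<in> global_max_points f"
    using max_type_points(2) by (auto simp: max_type_points_def)
  have K: "1 \<le> K" unfolding K_def by (rule max_type_ge_1)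
  define a where "a p = - point_strength f p / fact (2 * point_type f p)" for p
  \<comment> \<open>The Taylor coefficient is the strength over \<open>fact (2 * K)\<close>; its
    power \<open>- 1 / (2 * K)\<close> leaves this root of the factorial, the same for all points of
    type \<open>K\<close>.\<close>
  define C where "C = fact (2 * K) powr (1 / (2 * real K)) * exp_power_integral K"
  define s where "s n = real (Suc n) powr (1 / (2 * real K)) * exp (- (real (Suc n) * f m))" for n
  have meas: "f \<in> borel_measurable borel"
    using continuous_fCW by (rule borel_measurable_continuous_onI)
  have eq_m: "f p = f m" if "p \<in> global_max_points f" for p
    using that m by (auto simp: global_max_points_def intro: antisym)
  have weight: "a p powr (- 1 / (2 * real K)) * exp_power_integral K = C * cw_weight f p"
    if "p \<in> max_type_points f" for p
  proof -
    have p: "p \<in> global_max_points f" "point_type f p = K"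
      using that by (auto simp: max_type_points_def K_def)
    have powr_quot: "(x / y) powr (- 1 / (2 * real K)) = x powr (- 1 / (2 * real K)) * y powr (1 / (2 * real K))" for x y :: real
    proof -
      have inv: "y powr (- 1 / (2 * real K)) = inverse (y powr (1 / (2 * real K)))"
        by (simp only: minus_divide_left[symmetric] powr_minus)
      show ?thesis
        unfolding powr_divide inv by (simp only: divide_inverse inverse_inverse_eq)
    qed
    have "a p powr (- 1 / (2 * real K))
        = (- point_strength f p) powr (- 1 / (2 * real K)) * fact (2 * K) powr (1 / (2 * real K))"
      unfolding a_def p(2) by (rule powr_quot)
    then show ?thesis
      by (simp add: C_def cw_weight_def K_def)
  qed
  have main: "(\<lambda>n. of_real (s n) * (\<integral>x. \<phi> x * of_real (exp (real (Suc n) * f x)) \<partial>lborel))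
      \<longlonglongrightarrow> of_real C * (\<Sum>p\<in>max_type_points f. of_real (cw_weight f p) * \<phi> p)"
    if \<phi>: "continuous_on UNIV \<phi>" "\<And>x. norm (\<phi> x) \<le> B" for \<phi> :: "real \<Rightarrow> complex" and B
  proof -
    have "(\<lambda>n. real (Suc n) powr (1 / (2 * real K)) *\<^sub>R
         (\<integral>x. exp (real (Suc n) * (f x - f m)) *\<^sub>R \<phi> x \<partial>lborel))
      \<longlonglongrightarrow> (\<Sum>p\<in>{p \<in> global_max_points f. point_type f p = K}.
        (a p powr (- 1 / (2 * real K)) * exp_power_integral K) *\<^sub>R \<phi> p)"
    proof (rule laplace_global[OF meas \<phi> _ finite_max_points eq_m])
      show "integrable lborel (\<lambda>x. exp (f x))"
        using hubbard_stratonovich(1)[of 1] by (simp add: of_nat_Suc)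
      show "f x \<le> f m" for x
        using m by (simp add: global_max_points_def)
      show "\<exists>\<epsilon>>0. \<forall>x. x \<notin> S \<longrightarrow> f x \<le> f m - \<epsilon>" if "open S" "global_max_points f \<subseteq> S" for S
        by (rule global_max_points_coercive(3)[OF continuous_fCW fCW_at_bot that m])
      fix p assume p: "p \<in> global_max_points f"
      show "((\<lambda>z. (f (p + z) - f p) / z ^ (2 * point_type f p)) \<longlongrightarrow> - a p) (at 0)"
        using fCW_type(2)[OF p] by (simp add: a_def)
      show "0 < a p"
        using fCW_type(4)[OF p] by (simp add: a_def divide_neg_pos)
      show "1 \<le> point_type f p" "point_type f p \<le> K"
        using fCW_type(3)[OF p] max_type_ge[OF p] by (auto simp: K_def)
    qed
    moreover have "(\<Sum>p\<in>{p \<in> global_max_points f. point_type f p = K}.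
        (a p powr (- 1 / (2 * real K)) * exp_power_integral K) *\<^sub>R \<phi> p)
      = of_real C * (\<Sum>p\<in>max_type_points f. of_real (cw_weight f p) * \<phi> p)"
      unfolding sum_distrib_left max_type_points_eq[folded K_def, symmetric]
      by (intro sum.cong refl) (simp only: weight scaleR_conv_of_real of_real_mult mult.assoc)
    moreover have "real (Suc n) powr (1 / (2 * real K)) *\<^sub>R
         (\<integral>x. exp (real (Suc n) * (f x - f m)) *\<^sub>R \<phi> x \<partial>lborel)
      = of_real (s n) * (\<integral>x. \<phi> x * of_real (exp (real (Suc n) * f x)) \<partial>lborel)" for n
    proof -
      have "exp (real (Suc n) * (f x - f m)) *\<^sub>R \<phi> x
          = of_real (exp (- (real (Suc n) * f m))) * (\<phi> x * of_real (exp (real (Suc n) * f x)))" for x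
      proof -
        have "exp (real (Suc n) * (f x - f m)) = exp (- (real (Suc n) * f m)) * exp (real (Suc n) * f x)"
          by (simp add: algebra_simps flip: exp_add)
        then show ?thesis
          by (simp only: scaleR_conv_of_real of_real_mult mult_ac)
      qed
      then have "(\<integral>x. exp (real (Suc n) * (f x - f m)) *\<^sub>R \<phi> x \<partial>lborel)
          = of_real (exp (- (real (Suc n) * f m))) * (\<integral>x. \<phi> x * of_real (exp (real (Suc n) * f x)) \<partial>lborel)"
        by (simp only: integral_mult_right_zero)
      then show ?thesis
        by (simp only: s_def scaleR_conv_of_real of_real_mult mult.assoc)
    qed
    ultimately show ?thesis
      by (simp only:)
  qed
  have "C \<noteq> 0"
    using exp_power_integral_pos[OF K] by (simp add: C_def)
  moreover have "s n \<noteq> 0" for n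
    by (simp add: s_def)
  ultimately show ?thesis
    using that main by blast
qed

text \<open>A ratio of two instances of \<open>laplace_fCW\<close>, for the character
  \<open>iexp (t * x)\<close> and for the constant 1; the denominator has a nonzero limit because
  the weights are positive.\<close>

lemma char_magn_law_limit:
  "(\<lambda>n. char (magn_law \<rho> J h (Suc n)) t) \<longlonglongrightarrow>
    (\<Sum>p\<in>max_type_points f. of_real (cw_weight f p) * iexp (t * p)) / of_real (\<Sum>p\<in>max_type_points f. cw_weight f p)"
proof -
  obtain C s where C: "C \<noteq> 0" and lim:
    "\<And>\<phi> B. continuous_on UNIV \<phi> \<Longrightarrow> (\<And>x. norm (\<phi> x) \<le> B) \<Longrightarrow>
      (\<lambda>n. of_real (s n) * (\<integral>x. \<phi> x * of_real (exp (real (Suc n) * f x)) \<partial>lborel))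
      \<longlonglongrightarrow> of_real C * (\<Sum>p\<in>max_type_points f. of_real (cw_weight f p) * \<phi> p :: complex)"
    and s: "\<And>n. s n \<noteq> 0"
    by (rule laplace_fCW) blast
  define W where "W = (\<Sum>p\<in>max_type_points f. cw_weight f p)"
  have W: "W \<noteq> 0" using sum_cw_weight_pos by (simp add: W_def)
  define X where "X n = (\<integral>x. iexp (t * x) * of_real (exp (real (Suc n) * f x)) \<partial>lborel)" for n
  define Y where "Y n = (\<integral>x. complex_of_real (exp (real (Suc n) * f x)) \<partial>lborel)" for n
  define V where "V = (\<Sum>p\<in>max_type_points f. of_real (cw_weight f p) * iexp (t * p))"
  have X: "(\<lambda>n. of_real (s n) * X n) \<longlonglongrightarrow> of_real C * V"
    unfolding X_def V_def by (rule lim[of _ 1]) (auto intro!: continuous_intros)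
  have Y: "(\<lambda>n. of_real (s n) * Y n) \<longlonglongrightarrow> of_real C * of_real W"
    using lim[of "\<lambda>_. 1" 1] by (simp add: Y_def W_def)
  have "(\<lambda>n. (of_real (s n) * X n) / (of_real (s n) * Y n)) \<longlonglongrightarrow> (of_real C * V) / (of_real C * of_real W)"
    using C W by (intro tendsto_divide X Y) simp
  then have XY: "(\<lambda>n. X n / Y n) \<longlonglongrightarrow> V / of_real W"
    using s C by simp
  have "(\<lambda>n. exp (t\<^sup>2 / (2 * (real (Suc n) * J)))) \<longlonglongrightarrow> 1"
    using J_pos by real_asymp
  then have "(\<lambda>n. complex_of_real (exp (t\<^sup>2 / (2 * (real (Suc n) * J)))) * (X n / Y n)) \<longlonglongrightarrow> of_real 1 * (V / of_real W)"
    by (intro tendsto_mult tendsto_of_real XY)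
  then show ?thesis
    unfolding char_magn_law[OF zero_less_Suc] X_def[symmetric] Y_def[symmetric] V_def[symmetric] W_def[symmetric]
    by simp
qed

text \<open>\<open>embed_pmf\<close> has the intended mass function once the weights are known to be
  nonnegative with sum 1. The general codomain serves both characters and real test
  functions.\<close>

lemma integral_cw_limit:
  fixes g :: "real \<Rightarrow> 'b::{banach, second_countable_topology}"
  shows "integral\<^sup>L (cw_limit f) g
    = (\<Sum>p\<in>max_type_points f. (cw_weight f p / (\<Sum>p\<in>max_type_points f. cw_weight f p)) *\<^sub>R g p)"
proof -
  define A where "A = max_type_points f"
  define W where "W = (\<Sum>p\<in>A. cw_weight f p)"
  define w where "w x = (if x \<in> A then cw_weight f x / W else 0)" for x
  have A: "finite A" and W: "0 < W"
    using max_type_points(1) sum_cw_weight_pos by (auto simp: A_def W_def)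
  have w_nonneg: "0 \<le> w x" for x
    using cw_weight_pos[of x] W by (auto simp: w_def A_def intro!: divide_nonneg_pos less_imp_le)
  have "(\<integral>\<^sup>+x. w x \<partial>count_space UNIV) = (\<Sum>x\<in>A. ennreal (w x))"
    by (rule nn_integral_count_space'[OF A]) (auto simp: w_def)
  also have "\<dots> = ennreal (\<Sum>x\<in>A. w x)"
    by (rule sum_ennreal) (rule w_nonneg)
  also have "(\<Sum>x\<in>A. w x) = 1"
    using W by (simp add: w_def W_def flip: sum_divide_distrib)
  finally have prob: "(\<integral>\<^sup>+x. w x \<partial>count_space UNIV) = 1"
    by simp
  have pmf: "pmf (embed_pmf w) x = w x" for x
    by (rule pmf_embed_pmf[OF w_nonneg prob])
  have "integral\<^sup>L (measure_pmf (embed_pmf w)) g = (\<Sum>a\<in>A. pmf (embed_pmf w) a *\<^sub>R g a)"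
    by (rule integral_measure_pmf[OF A]) (auto simp: set_pmf_eq pmf w_def split: if_splits)
  moreover have "cw_limit f = measure_pmf (embed_pmf w)"
    unfolding cw_limit_def w_def A_def W_def ..
  ultimately show ?thesis
    by (simp add: pmf w_def A_def W_def)
qed

lemma weak_conv_magn_law: "weak_conv_to (magn_law \<rho> J h) (cw_limit f)"
proof -
  \<comment> \<open>\<open>cw_limit\<close> is a \<open>measure_pmf\<close>, where every set is
    measurable; pushing it along \<open>id\<close> moves it to the Borel sets that
    \<open>levy_continuity\<close> expects.\<close>
  define M where "M = distr (cw_limit f) borel id"
  have meas: "id \<in> measurable (cw_limit f) borel"
    by (simp add: cw_limit_def)
  have M: "real_distribution M"
    unfolding M_def cw_limit_def real_distribution_def real_distribution_axioms_def
    by (auto intro!: measure_pmf.prob_space_distr)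
  have int_M: "integral\<^sup>L M g = integral\<^sup>L (cw_limit f) g" if "g \<in> borel_measurable borel"
    for g :: "real \<Rightarrow> 'b::{banach, second_countable_topology}"
    using integral_distr[OF meas that] by (simp add: M_def)
  have laws: "real_distribution (magn_law \<rho> J h (Suc n))" for n
    by (rule real_distribution_magn_law) simp
  have "weak_conv_m (\<lambda>n. magn_law \<rho> J h (Suc n)) M"
  proof (rule levy_continuity[OF laws M])
    fix t
    have "char M t = (\<Sum>p\<in>max_type_points f. of_real (cw_weight f p) * iexp (t * p)) / of_real (\<Sum>p\<in>max_type_points f. cw_weight f p)"
      unfolding char_def by (subst int_M)
        (simp_all add: integral_cw_limit scaleR_conv_of_real sum_divide_distrib)
    then show "(\<lambda>n. char (magn_law \<rho> J h (Suc n)) t) \<longlonglongrightarrow> char M t"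
      using char_magn_law_limit[of t] by simp
  qed
  show ?thesis
    unfolding weak_conv_to_def
  proof (intro allI impI, elim conjE)
    fix g :: "real \<Rightarrow> real"
    assume g: "continuous_on UNIV g" "bounded (range g)"
    then obtain B where B: "\<And>x. norm (g x) \<le> B"
      unfolding bounded_iff by blast
    \<comment> \<open>\<open>levy_continuity\<close> gives convergence of distribution functions;
      here it is turned into convergence against bounded continuous functions.\<close>
    have "(\<lambda>n. integral\<^sup>L (magn_law \<rho> J h (Suc n)) g) \<longlonglongrightarrow> integral\<^sup>L M g"
      using g(1) B
      by (intro weak_conv_imp_integral_bdd_continuous_conv[OF laws M \<open>weak_conv_m _ M\<close>])
        (auto simp: continuous_on_eq_continuous_at)
    moreover have "integral\<^sup>L M g = integral\<^sup>L (cw_limit f) g"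
      using g(1) by (intro int_M borel_measurable_continuous_onI)
    ultimately have "(\<lambda>n. integral\<^sup>L (magn_law \<rho> J h (Suc n)) g) \<longlonglongrightarrow> integral\<^sup>L (cw_limit f) g"
      by (simp only:)
    \<comment> \<open>The finite-size identities were established for \<open>N > 0\<close>; shifting
      the index adds the single term \<open>N = 0\<close>, which does not affect the limit.\<close>
    then show "(\<lambda>n. integral\<^sup>L (magn_law \<rho> J h n) g) \<longlonglongrightarrow> integral\<^sup>L (cw_limit f) g"
      by (rule LIMSEQ_imp_Suc)
  qed
qed

end

theorem theorem1:
  fixes \<rho> :: "real measure" and J h :: real
  assumes "prob_space \<rho>"
    and "sets \<rho> = sets borel"
    and "\<forall>c. measure \<rho> {c} < 1"
    and "\<forall>a>0. \<forall>b. integrable \<rho> (\<lambda>x. exp (a * x\<^sup>2 / 2 + b * x))"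
    and "J > 0"
  shows "weak_conv_to (\<lambda>N. magn_law \<rho> J h N) (cw_limit (fCW \<rho> J h))"
proof -
  interpret prob_space \<rho> by fact
  interpret cw_model \<rho> J h
    using assms by unfold_locales auto
  show ?thesis
    by (rule weak_conv_magn_law)
qed

end
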